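(* Let $P$ be a program and let $p$ be a finite set of templates computed by the template algorithm for some cycles in $P$. Let $T$ be the classic symbolic execution tree of $P$, and let $T'$ be a compact symbolic execution tree of $P$ built using $p$ (with arbitrary choices of templates during its construction). Assume that the satisfiability function never returns UNKNOWN, so that neither $T$ nor $T'$ contains failed leaves. Then for each leaf node $e' \in T'$ there is a leaf node $e \in T$ and a valuation $\boldsymbol{\nu}$ of the parameters in $e'.s$ such that $e.s \equiv e'.s[\![\boldsymbol{\nu}]\!]$.
   Context: **Programs.** A program $P$ is a single flowgraph: a finite directed graph of locations with a starting location, over finitely many integer variables and read-only integer arrays (all called variables). Each edge is labelled by an instruction: an assignment to an integer variable, or a condition (a quantifier-free Boolean condition over variables). A branching location has two out-edges labelled by complementary conditions. Exit locations and error locations of $P$ have no out-edges; every other location has an out-edge. **Symbols, memories, states.** Each variable $\mathtt{a}$ has a symbol $\underline{a}$ (integer-valued for integer variables, a function $\mathbb{Z}\to\mathbb{Z}$ for arrays). Symbolic expressions are built from symbols, parameters (integer unknowns $\kappa$ distinct from symbols), constants, arithmetic operations, array reads, powers $c^{\kappa}$ (with $c^0=1$) and if-then-else $\mathbf{ite}(\cdot,\cdot,\cdot)$; formulae are first-order formulae over such expressions, with quantification over integers. A symbolic memory $\theta$ assigns to each variable a symbolic expression; $\theta_I$ is the memory with $\theta_I(\mathtt{a})=\underline{a}$ for all $\mathtt{a}$. A program state is a triple $s=(l,\theta,\varphi)$ of a location, a symbolic memory and a formula (path condition), with components $s.l$, $s.\theta$, $s.\varphi$. If $u$ is a tree node,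 $u.s$ is the state labelling it, and $u.l,u.\theta,u.\varphi$ are the components of $u.s$. Writing $s[\![\boldsymbol{\kappa}]\!]$ (likewise for $\theta$, $\varphi$) indicates that $\boldsymbol\kappa$ is the set of its (free) parameters. A valuation $\boldsymbol\nu$ is a function from a finite set of parameters to non-negative integers, and $s[\![\boldsymbol\nu]\!]$ (likewise $\theta[\![\boldsymbol\nu]\!],\varphi[\![\boldsymbol\nu]\!]$) is obtained by replacing all free occurrences of each parameter $\kappa$ by $\boldsymbol\nu(\kappa)$; for a single parameter one writes $\theta[\![\nu]\!]$ etc. with $\nu$ the integer (or expression) substituted. **Composition.** $\theta\langle\varphi\rangle$ is the formula or expression $\varphi$ with all symbols $\underline{a}$ simultaneously replaced by $\theta(\mathtt{a})$. $(\theta_1\diamond\theta_2)(\mathtt{a})=\theta_1\langle\theta_2(\mathtt{a})\rangle$. $(l_1,\theta_1,\varphi_1)\diamond(l_2,\theta_2,\varphi_2)=(l_2,\theta_1\diamond\theta_2,\varphi_1\wedge\theta_1\langle\varphi_2\rangle)$. **Equivalence.** $s_1\equiv s_2$ iff $s_1.l=s_2.l$, the formula $s_1.\theta(\mathtt{a})=s_2.\theta(\mathtt{a})$ is valid for each variable $\mathtt{a}$, and $s_1.\varphi$, $s_2.\varphi$ are logically equivalent. **Satisfiability function.** $\mathtt{satisfiable}(\varphi)$ returns SAT only if $\varphi$ is satisfiable, UNSAT only if $\varphi$ is unsatisfiable, and otherwise UNKNOWN. **Classic step.** For a state $s=(l,\theta,\varphi)$ the classic successors are, for each edge $(l,l')$: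 if labelled by an assignment $\mathtt{a}:=E$, the state $(l',\theta',\varphi)$ where $\theta'$ agrees with $\theta$ except $\theta'(\mathtt{a})$ is $E$ with each variable $\mathtt b$ replaced by $\theta(\mathtt b)$; if labelled by a condition $\gamma$, the state $(l',\theta,\varphi\wedge\gamma')$ where $\gamma'$ is $\gamma$ with each variable $\mathtt{b}$ replaced by $\theta(\mathtt{b})$ (the conjunct may be omitted if implied by $\varphi$). $\mathtt{executePath}(P,\rho)$ applies these steps along the path $\rho$, starting with memory $\theta_I$ and path condition $\mathit{true}$, and returns the resulting state. **Cycle.** Let $(u,e)$ be an edge of $P$, $\pi=e\omega e$ a cyclic path in $P$ such that $ue$ is not a suffix of $\pi$ and all nodes in $\omega e$ are pairwise distinct, and $X$ the set of all edges of $P$ that do not belong to $\pi$ but whose start nodes lie on $\pi$. Then $(\pi,e,X)$ is a cycle with core $\pi$, entry location $e$, and exit edges $X$. **Template algorithm.** Input: $P$ and a cycle $(\pi,e,X)$. Output: a template $(e,M)$, or failure. 1. $(e,\theta,\varphi):=\mathtt{executePath}(P,\pi)$. If $\mathtt{satisfiable}(\varphi)\ne$ SAT, fail. 2. Define a memory $\theta_*[\![\kappa]\!]$ with one parameter $\kappa$: $\theta_*[\![\kappa]\!](\mathtt{a})=\underline{a}$ for arrays; initially $\theta_*[\![\kappa]\!](\mathtt{a})=\bot$ (undefined) for integer variables. Repeat the following until nothing changes, for integer variables $\mathtt{a}$ with $\theta_*[\![\kappa]\!](\mathtt{a})=\bot$: if $\theta(\mathtt{a})=\underline{a}+c$ for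 a constant $c$, set $\theta_*[\![\kappa]\!](\mathtt{a}):=\underline{a}+\kappa\cdot c$; if $\theta(\mathtt{a})=\underline{a}\cdot c$ for a constant $c$, set $\theta_*[\![\kappa]\!](\mathtt{a}):=\underline{a}\cdot c^{\kappa}$; if $\theta(\mathtt{a})=g$ where $\theta_*[\![\kappa]\!](\mathtt{b})\neq\bot$ for each symbol $\underline{b}$ in $g$, set $\theta_*[\![\kappa]\!](\mathtt{a}):=\mathbf{ite}(\kappa>0,\theta_*[\![\kappa-1]\!]\langle g\rangle,\underline{a})$. If some variable remains $\bot$, fail. 3. $\varphi_*[\![\kappa]\!]:=\kappa\ge0\wedge\forall\tau(0\le\tau<\kappa\rightarrow\theta_*[\![\tau]\!]\langle\varphi\rangle)$. 4. $M:=\emptyset$. For each exit edge $(u,x)\in X$: let $\rho$ be the prefix of $\pi$ from $e$ to $u$ and $(x,\hat\theta,\hat\varphi):=\mathtt{executePath}(P,\rho x)$. If $\mathtt{satisfiable}(\hat\varphi)=$ UNKNOWN, fail. If it is SAT, add $(x,\ \theta_*[\![\kappa]\!]\diamond\hat\theta,\ \varphi_*[\![\kappa]\!]\wedge\theta_*[\![\kappa]\!]\langle\hat\varphi\rangle)$ to $M$. Finally return $(e,M)$. **Symbolic execution trees.** The tree (possibly infinite) has a root labelled by $(\text{starting location of }P,\theta_I,\mathit{true})$. Nodes are processed in breadth-first (queue) order. A node with state $s$ such that $s.l$ is an exit or an error location is not expanded. Any other node with state $s$ is expanded with a set $S$ of states. In the *classic* tree, $S$ is the set of classic successors of $s$.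 In a *compact* tree for a finite set $p$ of templates, one first chooses (arbitrarily) either no template, in which case $S$ is the set of classic successors, or some template $(s.l,M)\in p$ whose entry location is $s.l$; in the latter case the parameter in $M$ is renamed to a fresh parameter $\kappa$ and $S=\{s\diamond(l,\theta[\![\kappa]\!],\varphi[\![\kappa]\!]) : (l,\theta[\![\kappa]\!],\varphi[\![\kappa]\!])\in M\}$. Each $s'\in S$ with $\mathtt{satisfiable}(s'.\varphi)=$ SAT becomes the label of a new child to be processed later; each $s'\in S$ with answer UNKNOWN becomes the label of a new child that is never processed, called a failed leaf; states with answer UNSAT are discarded.
   Formalization: A leaf of T' is a childless node not expanded by a template; nodes expanded by a template with no satisfiable result are not counted as leaves, since for them the claim fails (e.g. a cycle without exit edges yields a childless node in T', while T is an infinite path with no leaf). *)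

theory Defs
  imports Main "HOL-Library.FSet" "HOL-Library.Sublist"
begin

text \<open>
  Integer variables have names in \<open>'v\<close>, array variables names in \<open>'w\<close>. Bound variables of formulae
  are de Bruijn indices; parameters are never bound. A variable occurring in a program expression is
  written as its symbol, so replacing each variable by its value in a memory and replacing each
  symbol by it are one operation.
\<close>

datatype 'v atom = Symbol 'v | Param nat | Bound nat

datatype 'w aexp = ASymbol 'w

datatype (iatoms: 'x, iarrays: 'w) iexp =
    Atom 'x
  | Const int
  | Neg "('x, 'w) iexp"
  | Add "('x, 'w) iexp" "('x, 'w) iexp"
  | Sub "('x, 'w) iexp" "('x, 'w) iexp"
  | Mul "('x, 'w) iexp" "('x, 'w) iexp"
  | Div "('x, 'w) iexp" "('x, 'w) iexp"
  | Mod "('x, 'w) iexp" "('x, 'w) iexp"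
  | Read "'w aexp" "('x, 'w) iexp"
  | Pow int "('x, 'w) iexp"
  | Ite "('x, 'w) bexp" "('x, 'w) iexp" "('x, 'w) iexp"
and (batoms: 'x, barrays: 'w) bexp =
    BTrue
  | Eq "('x, 'w) iexp" "('x, 'w) iexp"
  | Le "('x, 'w) iexp" "('x, 'w) iexp"
  | Less "('x, 'w) iexp" "('x, 'w) iexp"
  | BNot "('x, 'w) bexp"
  | BAnd "('x, 'w) bexp" "('x, 'w) bexp"
  | BOr "('x, 'w) bexp" "('x, 'w) bexp"

datatype (fatoms: 'x, farrays: 'w) form =
    Qf "('x, 'w) bexp"
  | FNot "('x, 'w) form"
  | FAnd "('x, 'w) form" "('x, 'w) form"
  | FOr "('x, 'w) form" "('x, 'w) form"
  | FImp "('x, 'w) form" "('x, 'w) form"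
  | FAll "('x, 'w) form"
  | FEx "('x, 'w) form"

type_synonym ('v, 'w) expr = "('v atom, 'w) iexp"
type_synonym ('v, 'w) cond = "('v atom, 'w) bexp"
type_synonym ('v, 'w) formula = "('v atom, 'w) form"


subsection \<open>Semantics\<close>

primrec aeval :: "('w \<Rightarrow> int \<Rightarrow> int) \<Rightarrow> 'w aexp \<Rightarrow> int \<Rightarrow> int" where
  "aeval A (ASymbol a) = A a"

text \<open>
  Powers are meant for non-negative exponents only; the value at a negative exponent (here \<open>1\<close>) is
  a dummy.
\<close>

primrec ieval :: "('x \<Rightarrow> int) \<Rightarrow> ('w \<Rightarrow> int \<Rightarrow> int) \<Rightarrow> ('x, 'w) iexp \<Rightarrow> int"
  and beval :: "('x \<Rightarrow> int) \<Rightarrow> ('w \<Rightarrow> int \<Rightarrow> int) \<Rightarrow> ('x, 'w) bexp \<Rightarrow> bool" where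
  "ieval I A (Atom x) = I x"
| "ieval I A (Const c) = c"
| "ieval I A (Neg e) = - ieval I A e"
| "ieval I A (Add e f) = ieval I A e + ieval I A f"
| "ieval I A (Sub e f) = ieval I A e - ieval I A f"
| "ieval I A (Mul e f) = ieval I A e * ieval I A f"
| "ieval I A (Div e f) = ieval I A e div ieval I A f"
| "ieval I A (Mod e f) = ieval I A e mod ieval I A f"
| "ieval I A (Read a e) = aeval A a (ieval I A e)"
| "ieval I A (Pow c e) = c ^ nat (ieval I A e)"
| "ieval I A (Ite b e f) = (if beval I A b then ieval I A e else ieval I A f)"
| "beval I A BTrue = True"
| "beval I A (Eq e f) = (ieval I A e = ieval I A f)"
| "beval I A (Le e f) = (ieval I A e \<le> ieval I A f)"
| "beval I A (Less e f) = (ieval I A e < ieval I A f)"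
| "beval I A (BNot b) = (\<not> beval I A b)"
| "beval I A (BAnd b c) = (beval I A b \<and> beval I A c)"
| "beval I A (BOr b c) = (beval I A b \<or> beval I A c)"

definition bind :: "int \<Rightarrow> ('v atom \<Rightarrow> int) \<Rightarrow> 'v atom \<Rightarrow> int" where
  "bind z I x = (case x of Bound 0 \<Rightarrow> z | Bound (Suc n) \<Rightarrow> I (Bound n) | _ \<Rightarrow> I x)"

primrec holds :: "('v atom \<Rightarrow> int) \<Rightarrow> ('w \<Rightarrow> int \<Rightarrow> int) \<Rightarrow> ('v atom, 'w) form \<Rightarrow> bool" where
  "holds I A (Qf b) = beval I A b"
| "holds I A (FNot \<phi>) = (\<not> holds I A \<phi>)"
| "holds I A (FAnd \<phi> \<psi>) = (holds I A \<phi> \<and> holds I A \<psi>)"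
| "holds I A (FOr \<phi> \<psi>) = (holds I A \<phi> \<or> holds I A \<psi>)"
| "holds I A (FImp \<phi> \<psi>) = (holds I A \<phi> \<longrightarrow> holds I A \<psi>)"
| "holds I A (FAll \<phi>) = (\<forall>z. holds (bind z I) A \<phi>)"
| "holds I A (FEx \<phi>) = (\<exists>z. holds (bind z I) A \<phi>)"

definition satisfiable :: "('v, 'w) formula \<Rightarrow> bool" where
  "satisfiable \<phi> \<longleftrightarrow> (\<exists>I A. holds I A \<phi>)"

definition implies :: "('v, 'w) formula \<Rightarrow> ('v, 'w) formula \<Rightarrow> bool" where
  "implies \<phi> \<psi> \<longleftrightarrow> (\<forall>I A. holds I A \<phi> \<longrightarrow> holds I A \<psi>)"

definition form_equiv :: "('v, 'w) formula \<Rightarrow> ('v, 'w) formula \<Rightarrow> bool" where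
  "form_equiv \<phi> \<psi> \<longleftrightarrow> (\<forall>I A. holds I A \<phi> \<longleftrightarrow> holds I A \<psi>)"

definition expr_equiv :: "('v, 'w) expr \<Rightarrow> ('v, 'w) expr \<Rightarrow> bool" where
  "expr_equiv e f \<longleftrightarrow> (\<forall>I A. ieval I A e = ieval I A f)"

definition aexp_equiv :: "'w aexp \<Rightarrow> 'w aexp \<Rightarrow> bool" where
  "aexp_equiv a b \<longleftrightarrow> (\<forall>A. aeval A a = aeval A b)"

datatype answer = SAT | UNSAT | UNKNOWN

definition sat_function :: "(('v, 'w) formula \<Rightarrow> answer) \<Rightarrow> bool" where
  "sat_function sat \<longleftrightarrow>
     (\<forall>\<phi>. (sat \<phi> = SAT \<longrightarrow> satisfiable \<phi>) \<and> (sat \<phi> = UNSAT \<longrightarrow> \<not> satisfiable \<phi>))"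


subsection \<open>Substitution\<close>

primrec asub :: "('w \<Rightarrow> 'w aexp) \<Rightarrow> 'w aexp \<Rightarrow> 'w aexp" where
  "asub g (ASymbol a) = g a"

primrec isub :: "('v atom \<Rightarrow> ('v, 'w) expr) \<Rightarrow> ('w \<Rightarrow> 'w aexp) \<Rightarrow> ('v atom, 'w) iexp \<Rightarrow> ('v, 'w) expr"
  and bsub :: "('v atom \<Rightarrow> ('v, 'w) expr) \<Rightarrow> ('w \<Rightarrow> 'w aexp) \<Rightarrow> ('v atom, 'w) bexp \<Rightarrow> ('v, 'w) cond"
  where
  "isub f g (Atom x) = f x"
| "isub f g (Const c) = Const c"
| "isub f g (Neg e) = Neg (isub f g e)"
| "isub f g (Add e e') = Add (isub f g e) (isub f g e')"
| "isub f g (Sub e e') = Sub (isub f g e) (isub f g e')"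
| "isub f g (Mul e e') = Mul (isub f g e) (isub f g e')"
| "isub f g (Div e e') = Div (isub f g e) (isub f g e')"
| "isub f g (Mod e e') = Mod (isub f g e) (isub f g e')"
| "isub f g (Read a e) = Read (asub g a) (isub f g e)"
| "isub f g (Pow c e) = Pow c (isub f g e)"
| "isub f g (Ite b e e') = Ite (bsub f g b) (isub f g e) (isub f g e')"
| "bsub f g BTrue = BTrue"
| "bsub f g (Eq e e') = Eq (isub f g e) (isub f g e')"
| "bsub f g (Le e e') = Le (isub f g e) (isub f g e')"
| "bsub f g (Less e e') = Less (isub f g e) (isub f g e')"
| "bsub f g (BNot b) = BNot (bsub f g b)"
| "bsub f g (BAnd b b') = BAnd (bsub f g b) (bsub f g b')"
| "bsub f g (BOr b b') = BOr (bsub f g b) (bsub f g b')"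

definition lift :: "('v, 'w) expr \<Rightarrow> ('v, 'w) expr" where
  "lift = isub (\<lambda>x. case x of Bound n \<Rightarrow> Atom (Bound (Suc n)) | _ \<Rightarrow> Atom x) ASymbol"

definition up :: "('v atom \<Rightarrow> ('v, 'w) expr) \<Rightarrow> 'v atom \<Rightarrow> ('v, 'w) expr" where
  "up f x = (case x of Bound 0 \<Rightarrow> Atom (Bound 0) | Bound (Suc n) \<Rightarrow> lift (f (Bound n)) | _ \<Rightarrow> lift (f x))"

primrec fsub :: "('v atom \<Rightarrow> ('v, 'w) expr) \<Rightarrow> ('w \<Rightarrow> 'w aexp) \<Rightarrow> ('v atom, 'w) form \<Rightarrow> ('v, 'w) formula"
  where
  "fsub f g (Qf b) = Qf (bsub f g b)"
| "fsub f g (FNot \<phi>) = FNot (fsub f g \<phi>)"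
| "fsub f g (FAnd \<phi> \<psi>) = FAnd (fsub f g \<phi>) (fsub f g \<psi>)"
| "fsub f g (FOr \<phi> \<psi>) = FOr (fsub f g \<phi>) (fsub f g \<psi>)"
| "fsub f g (FImp \<phi> \<psi>) = FImp (fsub f g \<phi>) (fsub f g \<psi>)"
| "fsub f g (FAll \<phi>) = FAll (fsub (up f) g \<phi>)"
| "fsub f g (FEx \<phi>) = FEx (fsub (up f) g \<phi>)"


subsection \<open>Memories and states\<close>

text \<open>
  Memories are total on names; on names that are not variables of the program at hand all memories
  arising below are the identity.
\<close>

record ('v, 'w) memory =
  ival :: "'v \<Rightarrow> ('v, 'w) expr"
  aval :: "'w \<Rightarrow> 'w aexp"

record ('l, 'v, 'w) state =
  loc :: 'l
  mem :: "('v, 'w) memory"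
  pc :: "('v, 'w) formula"

definition state :: "'l \<Rightarrow> ('v, 'w) memory \<Rightarrow> ('v, 'w) formula \<Rightarrow> ('l, 'v, 'w) state" where
  "state l \<theta> \<phi> = \<lparr>loc = l, mem = \<theta>, pc = \<phi>\<rparr>"

definition init_mem :: "('v, 'w) memory" where
  "init_mem = \<lparr>ival = (\<lambda>a. Atom (Symbol a)), aval = ASymbol\<rparr>"

definition symsub :: "('v, 'w) memory \<Rightarrow> 'v atom \<Rightarrow> ('v, 'w) expr" where
  "symsub \<theta> x = (case x of Symbol a \<Rightarrow> ival \<theta> a | _ \<Rightarrow> Atom x)"

definition iapply :: "('v, 'w) memory \<Rightarrow> ('v, 'w) expr \<Rightarrow> ('v, 'w) expr" where
  "iapply \<theta> = isub (symsub \<theta>) (aval \<theta>)"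

definition bapply :: "('v, 'w) memory \<Rightarrow> ('v, 'w) cond \<Rightarrow> ('v, 'w) cond" where
  "bapply \<theta> = bsub (symsub \<theta>) (aval \<theta>)"

definition fapply :: "('v, 'w) memory \<Rightarrow> ('v, 'w) formula \<Rightarrow> ('v, 'w) formula" where
  "fapply \<theta> = fsub (symsub \<theta>) (aval \<theta>)"

definition mem_comp :: "('v, 'w) memory \<Rightarrow> ('v, 'w) memory \<Rightarrow> ('v, 'w) memory" where
  "mem_comp \<theta>\<^sub>1 \<theta>\<^sub>2 =
     \<lparr>ival = (\<lambda>a. iapply \<theta>\<^sub>1 (ival \<theta>\<^sub>2 a)), aval = (\<lambda>a. asub (aval \<theta>\<^sub>1) (aval \<theta>\<^sub>2 a))\<rparr>"

definition state_comp :: "('l, 'v, 'w) state \<Rightarrow> ('l, 'v, 'w) state \<Rightarrow> ('l, 'v, 'w) state" where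
  "state_comp s\<^sub>1 s\<^sub>2 =
     state (loc s\<^sub>2) (mem_comp (mem s\<^sub>1) (mem s\<^sub>2)) (FAnd (pc s\<^sub>1) (fapply (mem s\<^sub>1) (pc s\<^sub>2)))"

definition parsub :: "(nat \<Rightarrow> ('v, 'w) expr) \<Rightarrow> 'v atom \<Rightarrow> ('v, 'w) expr" where
  "parsub f x = (case x of Param k \<Rightarrow> f k | _ \<Rightarrow> Atom x)"

definition mem_parsub :: "(nat \<Rightarrow> ('v, 'w) expr) \<Rightarrow> ('v, 'w) memory \<Rightarrow> ('v, 'w) memory" where
  "mem_parsub f \<theta> = \<theta>\<lparr>ival := (\<lambda>a. isub (parsub f) ASymbol (ival \<theta> a))\<rparr>"

definition state_parsub ::
  "(nat \<Rightarrow> ('v, 'w) expr) \<Rightarrow> ('l, 'v, 'w) state \<Rightarrow> ('l, 'v, 'w) state" where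
  "state_parsub f s =
     state (loc s) (mem_parsub f (mem s)) (fsub (parsub f) ASymbol (pc s))"

definition state_params :: "('l, 'v, 'w) state \<Rightarrow> nat set" where
  "state_params s = {k. (\<exists>a. Param k \<in> iatoms (ival (mem s) a)) \<or> Param k \<in> fatoms (pc s)}"

type_synonym valuation = "nat \<rightharpoonup> nat"

definition valuation_of :: "nat set \<Rightarrow> valuation \<Rightarrow> bool" where
  "valuation_of K \<nu> \<longleftrightarrow> finite (dom \<nu>) \<and> dom \<nu> = K"

definition instantiate :: "valuation \<Rightarrow> ('l, 'v, 'w) state \<Rightarrow> ('l, 'v, 'w) state" where
  "instantiate \<nu> =
     state_parsub (\<lambda>k. case \<nu> k of Some n \<Rightarrow> Const (int n) | None \<Rightarrow> Atom (Param k))"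


subsection \<open>Programs\<close>

datatype ('v, 'w) instr = Assign 'v "('v, 'w) expr" | Assume "('v, 'w) cond"

record ('l, 'v, 'w) program =
  locs :: "'l set"
  start :: 'l
  exits :: "'l set"
  errors :: "'l set"
  edges :: "('l \<times> 'l) set"
  instr :: "'l \<times> 'l \<Rightarrow> ('v, 'w) instr"
  ivars :: "'v set"
  avars :: "'w set"

fun wf_instr :: "'v set \<Rightarrow> 'w set \<Rightarrow> ('v, 'w) instr \<Rightarrow> bool" where
  "wf_instr V W (Assign a E) \<longleftrightarrow> a \<in> V \<and> iatoms E \<subseteq> Symbol ` V \<and> iarrays E \<subseteq> W"
| "wf_instr V W (Assume \<gamma>) \<longleftrightarrow> batoms \<gamma> \<subseteq> Symbol ` V \<and> barrays \<gamma> \<subseteq> W"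

definition complementary :: "('v, 'w) instr \<Rightarrow> ('v, 'w) instr \<Rightarrow> bool" where
  "complementary i j \<longleftrightarrow>
     (\<exists>\<gamma> \<delta>. i = Assume \<gamma> \<and> j = Assume \<delta> \<and> (\<forall>I A. beval I A \<delta> \<longleftrightarrow> \<not> beval I A \<gamma>))"

definition final_locs :: "('l, 'v, 'w) program \<Rightarrow> 'l set" where
  "final_locs P = exits P \<union> errors P"

definition succs :: "('l, 'v, 'w) program \<Rightarrow> 'l \<Rightarrow> 'l set" where
  "succs P l = {l'. (l, l') \<in> edges P}"

definition wf_program :: "('l, 'v, 'w) program \<Rightarrow> bool" where
  "wf_program P \<longleftrightarrow>
     finite (locs P) \<and> finite (ivars P) \<and> finite (avars P) \<and>
     start P \<in> locs P \<and> final_locs P \<subseteq> locs P \<and> edges P \<subseteq> locs P \<times> locs P \<and>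
     (\<forall>l \<in> final_locs P. succs P l = {}) \<and>
     (\<forall>l \<in> locs P - final_locs P.
        (\<exists>l'. succs P l = {l'}) \<or>
        (\<exists>l\<^sub>1 l\<^sub>2. l\<^sub>1 \<noteq> l\<^sub>2 \<and> succs P l = {l\<^sub>1, l\<^sub>2} \<and>
           complementary (instr P (l, l\<^sub>1)) (instr P (l, l\<^sub>2)))) \<and>
     (\<forall>ed \<in> edges P. wf_instr (ivars P) (avars P) (instr P ed))"

definition state_equiv ::
  "('l, 'v, 'w) program \<Rightarrow> ('l, 'v, 'w) state \<Rightarrow> ('l, 'v, 'w) state \<Rightarrow> bool" where
  "state_equiv P s\<^sub>1 s\<^sub>2 \<longleftrightarrow>
     loc s\<^sub>1 = loc s\<^sub>2 \<and>
     (\<forall>a \<in> ivars P. expr_equiv (ival (mem s\<^sub>1) a) (ival (mem s\<^sub>2) a)) \<and>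
     (\<forall>a \<in> avars P. aexp_equiv (aval (mem s\<^sub>1) a) (aval (mem s\<^sub>2) a)) \<and>
     form_equiv (pc s\<^sub>1) (pc s\<^sub>2)"


subsection \<open>Classic steps\<close>

text \<open>\<open>step P s l' s'\<close>: \<open>s'\<close> is a classic successor of \<open>s\<close> along the edge \<open>(loc s, l')\<close>.\<close>

inductive step ::
  "('l, 'v, 'w) program \<Rightarrow> ('l, 'v, 'w) state \<Rightarrow> 'l \<Rightarrow> ('l, 'v, 'w) state \<Rightarrow> bool"
  for P where
  assign: "(l, l') \<in> edges P \<Longrightarrow> instr P (l, l') = Assign a E \<Longrightarrow>
    step P (state l \<theta> \<phi>) l' (state l' (\<theta>\<lparr>ival := (ival \<theta>)(a := iapply \<theta> E)\<rparr>) \<phi>)"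
| condition: "(l, l') \<in> edges P \<Longrightarrow> instr P (l, l') = Assume \<gamma> \<Longrightarrow>
    step P (state l \<theta> \<phi>) l' (state l' \<theta> (FAnd \<phi> (Qf (bapply \<theta> \<gamma>))))"
| implied_condition: "(l, l') \<in> edges P \<Longrightarrow> instr P (l, l') = Assume \<gamma> \<Longrightarrow>
    implies \<phi> (Qf (bapply \<theta> \<gamma>)) \<Longrightarrow>
    step P (state l \<theta> \<phi>) l' (state l' \<theta> \<phi>)"

inductive exec_path :: "('l, 'v, 'w) program \<Rightarrow> 'l list \<Rightarrow> ('l, 'v, 'w) state \<Rightarrow> bool"
  for P where
  start: "exec_path P [l] (state l init_mem (Qf BTrue))"
| extend: "exec_path P \<rho> s \<Longrightarrow> step P s l' s' \<Longrightarrow> exec_path P (\<rho> @ [l']) s'"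


subsection \<open>Cycles and templates\<close>

definition path_edges :: "'l list \<Rightarrow> ('l \<times> 'l) set" where
  "path_edges \<pi> = set (zip \<pi> (tl \<pi>))"

definition is_cycle ::
  "('l, 'v, 'w) program \<Rightarrow> 'l list \<Rightarrow> 'l \<Rightarrow> ('l \<times> 'l) set \<Rightarrow> bool" where
  "is_cycle P \<pi> e X \<longleftrightarrow>
     (\<exists>u \<omega>. (u, e) \<in> edges P \<and> \<pi> = [e] @ \<omega> @ [e] \<and> path_edges \<pi> \<subseteq> edges P \<and>
        \<not> suffix [u, e] \<pi> \<and> distinct (\<omega> @ [e])) \<and>
     X = {(v, x). (v, x) \<in> edges P \<and> v \<in> set \<pi> \<and> (v, x) \<notin> path_edges \<pi>}"

text \<open>The parameter of a template is \<open>Param 0\<close>; it is renamed whenever the template is used.\<close>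

type_synonym ('l, 'v, 'w) template = "'l \<times> ('l, 'v, 'w) state set"

abbreviation kappa :: "('v, 'w) expr" where
  "kappa \<equiv> Atom (Param 0)"

text \<open>
  Memories under construction: \<open>None\<close> stands for an undefined value. In \<open>mem_of\<close> the value chosen
  for undefined entries is a dummy.
\<close>

definition mem_of :: "('v \<Rightarrow> ('v, 'w) expr option) \<Rightarrow> ('v, 'w) memory" where
  "mem_of m = \<lparr>ival = (\<lambda>a. case m a of Some e \<Rightarrow> e | None \<Rightarrow> Atom (Symbol a)), aval = ASymbol\<rparr>"

definition kappa_inst :: "('v, 'w) expr \<Rightarrow> ('v, 'w) memory \<Rightarrow> ('v, 'w) memory" where
  "kappa_inst e = mem_parsub (\<lambda>k. if k = 0 then e else Atom (Param k))"

text \<open>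
  \<open>cycle_mem P \<theta> m\<close>: \<open>m\<close> is reached in the construction of the memory after \<open>\<kappa>\<close> iterations of a
  cycle with effect \<open>\<theta>\<close>. Whether \<open>\<theta>\<close> maps a variable to an expression of a given shape is understood
  up to validity of the equation, as the results of path execution are not simplified.
\<close>

inductive cycle_mem ::
  "('l, 'v, 'w) program \<Rightarrow> ('v, 'w) memory \<Rightarrow> ('v \<Rightarrow> ('v, 'w) expr option) \<Rightarrow> bool"
  for P \<theta> where
  init: "cycle_mem P \<theta> (\<lambda>a. if a \<in> ivars P then None else Some (Atom (Symbol a)))"
| add_const: "cycle_mem P \<theta> m \<Longrightarrow> a \<in> ivars P \<Longrightarrow> m a = None \<Longrightarrow>
    expr_equiv (ival \<theta> a) (Add (Atom (Symbol a)) (Const c)) \<Longrightarrow>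
    cycle_mem P \<theta> (m(a \<mapsto> Add (Atom (Symbol a)) (Mul kappa (Const c))))"
| mul_const: "cycle_mem P \<theta> m \<Longrightarrow> a \<in> ivars P \<Longrightarrow> m a = None \<Longrightarrow>
    expr_equiv (ival \<theta> a) (Mul (Atom (Symbol a)) (Const c)) \<Longrightarrow>
    cycle_mem P \<theta> (m(a \<mapsto> Mul (Atom (Symbol a)) (Pow c kappa)))"
| derived: "cycle_mem P \<theta> m \<Longrightarrow> a \<in> ivars P \<Longrightarrow> m a = None \<Longrightarrow>
    expr_equiv (ival \<theta> a) g \<Longrightarrow> iatoms g \<subseteq> Symbol ` dom m \<Longrightarrow>
    cycle_mem P \<theta> (m(a \<mapsto>
      Ite (Less (Const 0) kappa)
        (iapply (kappa_inst (Sub kappa (Const 1)) (mem_of m)) g)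
        (Atom (Symbol a))))"

text \<open>
  The arguments contain no bound variables, so nothing is lifted under the quantifier; \<open>Bound 0\<close> is
  the \<open>\<tau>\<close> of the formula \<open>\<kappa> \<ge> 0 \<and> (\<forall>\<tau>. 0 \<le> \<tau> < \<kappa> \<longrightarrow> \<theta>\<^sub>*[\<tau>]\<langle>\<phi>\<rangle>)\<close>.
\<close>

definition cycle_pc :: "('v, 'w) memory \<Rightarrow> ('v, 'w) formula \<Rightarrow> ('v, 'w) formula" where
  "cycle_pc \<theta>s \<phi> =
     FAnd (Qf (Le (Const 0) kappa))
       (FAll (FImp
         (Qf (BAnd (Le (Const 0) (Atom (Bound 0))) (Less (Atom (Bound 0)) kappa)))
         (fapply (kappa_inst (Atom (Bound 0)) \<theta>s) \<phi>)))"

definition prefix_to :: "'l \<Rightarrow> 'l list \<Rightarrow> 'l list" where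
  "prefix_to u \<pi> = takeWhile (\<lambda>v. v \<noteq> u) \<pi> @ [u]"

text \<open>
  The function \<open>r\<close> gives the result of path execution for each exit edge. It is not determined by the
  edge, as implied conditions may be omitted. Note that \<open>state_comp\<close> with first argument
  \<open>state _ \<theta>\<^sub>* \<phi>\<^sub>*\<close> has exactly the three components of an element of \<open>M\<close>.
\<close>

inductive template_alg ::
  "('l, 'v, 'w) program \<Rightarrow> (('v, 'w) formula \<Rightarrow> answer) \<Rightarrow> 'l list \<Rightarrow> 'l \<Rightarrow> ('l \<times> 'l) set \<Rightarrow>
   ('l, 'v, 'w) template \<Rightarrow> bool"
  for P sat \<pi> e X where
  success: "exec_path P \<pi> (state e \<theta> \<phi>) \<Longrightarrow> sat \<phi> = SAT \<Longrightarrow>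
    cycle_mem P \<theta> m \<Longrightarrow> (\<forall>a. m a \<noteq> None) \<Longrightarrow>
    (\<forall>(u, x) \<in> X. exec_path P (prefix_to u \<pi> @ [x]) (r (u, x)) \<and> sat (pc (r (u, x))) \<noteq> UNKNOWN) \<Longrightarrow>
    M = {state_comp (state e (mem_of m) (cycle_pc (mem_of m) \<phi>)) (r ed) |ed.
          ed \<in> X \<and> sat (pc (r ed)) = SAT} \<Longrightarrow>
    template_alg P sat \<pi> e X (e, M)"


subsection \<open>Symbolic execution trees\<close>

text \<open>
  A tree is its root node. \<open>applied\<close> records the template with which the node was expanded; it is
  \<open>None\<close> for classically expanded nodes and for nodes that are not expanded. A set of states is
  turned into one child per state (\<open>inj_on label\<close>).
\<close>

codatatype ('l, 'v, 'w) stree =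
  Node (label: "('l, 'v, 'w) state") (applied: "('l, 'v, 'w) template option")
    (children: "('l, 'v, 'w) stree fset")

definition classic_expansion ::
  "('l, 'v, 'w) program \<Rightarrow> ('l, 'v, 'w) state \<Rightarrow> ('l, 'v, 'w) template option \<Rightarrow>
   ('l, 'v, 'w) state set \<Rightarrow> bool" where
  "classic_expansion P s t S \<longleftrightarrow>
     t = None \<and> (\<exists>f. (\<forall>l' \<in> succs P (loc s). step P s l' (f l')) \<and> S = f ` succs P (loc s))"

definition rename_kappa :: "nat \<Rightarrow> ('l, 'v, 'w) state \<Rightarrow> ('l, 'v, 'w) state" where
  "rename_kappa k = state_parsub (\<lambda>j. Atom (Param (if j = 0 then k else j)))"

inductive compact_expansion ::
  "('l, 'v, 'w) program \<Rightarrow> ('l, 'v, 'w) template set \<Rightarrow> ('l, 'v, 'w) state \<Rightarrow>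
   ('l, 'v, 'w) template option \<Rightarrow> ('l, 'v, 'w) state set \<Rightarrow> bool"
  for P p where
  no_template: "classic_expansion P s None S \<Longrightarrow> compact_expansion P p s None S"
| use_template: "(loc s, M) \<in> p \<Longrightarrow> k \<notin> state_params s \<Longrightarrow>
    compact_expansion P p s (Some (loc s, M)) ((\<lambda>s'. state_comp s (rename_kappa k s')) ` M)"

text \<open>
  \<open>grown P sat expn t\<close>: \<open>t\<close> is a tree, with an arbitrary root label, obtained by processing its root
  and every node labelled by a state answered SAT. Breadth-first order guarantees just that each
  such node is processed eventually.
\<close>

coinductive grown ::
  "('l, 'v, 'w) program \<Rightarrow> (('v, 'w) formula \<Rightarrow> answer) \<Rightarrow>
   (('l, 'v, 'w) state \<Rightarrow> ('l, 'v, 'w) template option \<Rightarrow> ('l, 'v, 'w) state set \<Rightarrow> bool) \<Rightarrow>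
   ('l, 'v, 'w) stree \<Rightarrow> bool"
  for P sat expn where
  final: "loc s \<in> final_locs P \<Longrightarrow> grown P sat expn (Node s None {||})"
| expand: "loc s \<notin> final_locs P \<Longrightarrow> expn s tmpl S \<Longrightarrow>
    inj_on label (fset C) \<Longrightarrow> label ` fset C = {s' \<in> S. sat (pc s') \<noteq> UNSAT} \<Longrightarrow>
    (\<forall>c \<in> fset C. if sat (pc (label c)) = SAT then grown P sat expn c
                  else c = Node (label c) None {||}) \<Longrightarrow>
    grown P sat expn (Node s tmpl C)"

definition root_state :: "('l, 'v, 'w) program \<Rightarrow> ('l, 'v, 'w) state" where
  "root_state P = state (start P) init_mem (Qf BTrue)"

definition classic_tree ::
  "('l, 'v, 'w) program \<Rightarrow> (('v, 'w) formula \<Rightarrow> answer) \<Rightarrow> ('l, 'v, 'w) stree \<Rightarrow> bool" where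
  "classic_tree P sat T \<longleftrightarrow> label T = root_state P \<and> grown P sat (classic_expansion P) T"

definition compact_tree ::
  "('l, 'v, 'w) program \<Rightarrow> (('v, 'w) formula \<Rightarrow> answer) \<Rightarrow> ('l, 'v, 'w) template set \<Rightarrow>
   ('l, 'v, 'w) stree \<Rightarrow> bool" where
  "compact_tree P sat p T \<longleftrightarrow> label T = root_state P \<and> grown P sat (compact_expansion P p) T"

inductive_set nodes :: "('l, 'v, 'w) stree \<Rightarrow> ('l, 'v, 'w) stree set" for T where
  root: "T \<in> nodes T"
| child: "u \<in> nodes T \<Longrightarrow> c \<in> fset (children u) \<Longrightarrow> c \<in> nodes T"

text \<open>
  Leaves are the nodes without children at which an execution stops: exit, error and failed leaves,
  and classically expanded nodes without feasible successor. A node expanded with a template all of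
  whose results are discarded does not count: it represents executions that never leave the cycle,
  such as those of \<open>while (true) x := x + 1\<close>, and in the classic tree these are infinite paths.
\<close>

definition leaf :: "('l, 'v, 'w) stree \<Rightarrow> bool" where
  "leaf u \<longleftrightarrow> children u = {||} \<and> applied u = None"

end

theory Submission
  imports Defs
begin

text \<open>
  For concrete integers as parameters, every node of the compact tree denotes a single path of the
  program: a template node with parameter value \<open>n\<close> stands for \<open>n\<close> iterations of the cycle followed
  by the way to an exit edge. A state that denotes a path maps initial values to the values after
  the path, and its path condition holds exactly for the initial values from which the path is
  feasible; hence two states denoting the same path are equivalent. Feasible paths are present in
  the classic tree. A model of the path condition of a leaf of the compact tree yields the parameter
  values, which are non-negative because every template result contains \<open>\<kappa> \<ge> 0\<close>.
\<close>

section \<open>Evaluation and substitution\<close>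

lemma ieval_cong:
  fixes e :: "('x, 'w) iexp" and b :: "('x, 'w) bexp"
  shows "(\<And>x. x \<in> iatoms e \<Longrightarrow> I x = J x) \<Longrightarrow> ieval I A e = ieval J A e"
    and "(\<And>x. x \<in> batoms b \<Longrightarrow> I x = J x) \<Longrightarrow> beval I A b = beval J A b"
  by (induction e and b) simp_all

lemma aeval_asub: "aeval A (asub g e) = aeval (\<lambda>a. aeval A (g a)) e"
  by (cases e) simp

lemma ieval_isub:
  fixes e :: "('v atom, 'w) iexp" and b :: "('v atom, 'w) bexp"
  shows "ieval I A (isub f g e) = ieval (\<lambda>x. ieval I A (f x)) (\<lambda>a. aeval A (g a)) e"
    and "beval I A (bsub f g b) = beval (\<lambda>x. ieval I A (f x)) (\<lambda>a. aeval A (g a)) b"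
  by (induction e and b) (simp_all add: aeval_asub)

lemma ieval_lift: "ieval (bind z I) A (lift e) = ieval I A e"
  unfolding lift_def ieval_isub
  by (auto intro!: ieval_cong simp: bind_def split: atom.split)

text \<open>The usual substitution lemma. Under a quantifier it rests on \<open>up\<close> mirroring
  \<open>bind\<close>: index 0 keeps the quantified value, and all other images are lifted past
  it.\<close>

lemma holds_fsub:
  "holds I A (fsub f g \<phi>) = holds (\<lambda>x. ieval I A (f x)) (\<lambda>a. aeval A (g a)) \<phi>"
proof -
  have up: "(\<lambda>x. ieval (bind z I) A (up f x)) = bind z (\<lambda>x. ieval I A (f x))" for z f I
    by (rule ext) (auto simp: up_def ieval_lift bind_def split: atom.split nat.split)
  show ?thesis
    by (induction \<phi> arbitrary: I f) (simp_all add: ieval_isub up)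
qed

text \<open>Agreement on all symbols and indices passes through \<open>bind\<close>, and parameters
  are never bound. Restricting the last premise to occurring parameters later allows a valuation
  that is undefined on all others.\<close>

lemma holds_cong:
  assumes "\<And>a. I (Symbol a) = J (Symbol a)" and "\<And>n. I (Bound n) = J (Bound n)"
    and "\<And>k. Param k \<in> fatoms \<phi> \<Longrightarrow> I (Param k) = J (Param k)"
  shows "holds I A \<phi> \<longleftrightarrow> holds J A \<phi>"
  using assms
proof (induction \<phi> arbitrary: I J)
  case (Qf b)
  have "beval I A b = beval J A b"
  proof (rule ieval_cong)
    show "I x = J x" if "x \<in> batoms b" for x
      using Qf that by (cases x rule: atom.exhaust) auto
  qed
  then show ?case by simp
next
  case (FAll \<phi>)
  have "holds (bind z I) A \<phi> = holds (bind z J) A \<phi>" for z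
    by (rule FAll.IH) (use FAll.prems in \<open>auto simp: bind_def split: nat.split\<close>)
  then show ?case by simp
next
  case (FEx \<phi>)
  have "holds (bind z I) A \<phi> = holds (bind z J) A \<phi>" for z
    by (rule FEx.IH) (use FEx.prems in \<open>auto simp: bind_def split: nat.split\<close>)
  then show ?case by simp
next
  case (FNot \<phi>)
  have "holds I A \<phi> = holds J A \<phi>" by (rule FNot.IH) (use FNot.prems in auto)
  then show ?case by simp
next
  case (FAnd \<phi> \<psi>)
  have "holds I A \<phi> = holds J A \<phi>" "holds I A \<psi> = holds J A \<psi>"
    by (rule FAnd.IH; use FAnd.prems in auto)+
  then show ?case by simp
next
  case (FOr \<phi> \<psi>)
  have "holds I A \<phi> = holds J A \<phi>" "holds I A \<psi> = holds J A \<psi>"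
    by (rule FOr.IH; use FOr.prems in auto)+
  then show ?case by simp
next
  case (FImp \<phi> \<psi>)
  have "holds I A \<phi> = holds J A \<phi>" "holds I A \<psi> = holds J A \<psi>"
    by (rule FImp.IH; use FImp.prems in auto)+
  then show ?case by simp
qed

section \<open>Parameters occurring after a substitution\<close>

lemma iatoms_isub:
  fixes e :: "('v atom, 'w) iexp" and b :: "('v atom, 'w) bexp"
  shows "iatoms (isub f g e) = (\<Union>x\<in>iatoms e. iatoms (f x))"
    and "batoms (bsub f g b) = (\<Union>x\<in>batoms b. iatoms (f x))"
  by (induction e and b) auto

lemma Param_in_iatoms_lift: "Param k \<in> iatoms (lift e) \<Longrightarrow> Param k \<in> iatoms e"
  by (auto simp: lift_def iatoms_isub split: atom.splits) (metis atom.exhaust)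

text \<open>\<open>fatoms\<close> collects indices as they stand below quantifiers, without shifting
  them back, so a parameter in the image of an index would be hard to trace. A substitution that
  fixes all indices avoids this, and \<open>up\<close> preserves that property.\<close>

lemma Param_in_fatoms_fsub:
  assumes "Param k \<in> fatoms (fsub f g \<phi>)" and "\<And>n. f (Bound n) = Atom (Bound n)"
  shows "\<exists>x\<in>fatoms \<phi>. Param k \<in> iatoms (f x)"
proof -
  have up_bound: "up f (Bound n) = Atom (Bound n)" if "\<And>n. f (Bound n) = Atom (Bound n)"
    for f :: "'a atom \<Rightarrow> ('a, 'b) expr" and n
    using that by (cases n) (simp_all add: up_def lift_def)
  have up_param: "Param k \<in> iatoms (f x)"
    if "\<And>n. f (Bound n) = Atom (Bound n)" "Param k \<in> iatoms (up f x)"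
    for f :: "'a atom \<Rightarrow> ('a, 'b) expr" and x
    using that by (auto simp: up_def split: atom.splits nat.splits dest!: Param_in_iatoms_lift)
  show ?thesis
    using assms
  proof (induction \<phi> arbitrary: f)
    case (FAll \<phi>)
    have "\<exists>x\<in>fatoms \<phi>. Param k \<in> iatoms (up f x)"
      using FAll.prems by (intro FAll.IH) (simp_all add: up_bound)
    then show ?case using up_param[OF FAll.prems(2)] by auto
  next
    case (FEx \<phi>)
    have "\<exists>x\<in>fatoms \<phi>. Param k \<in> iatoms (up f x)"
      using FEx.prems by (intro FEx.IH) (simp_all add: up_bound)
    then show ?case using up_param[OF FEx.prems(2)] by auto
  qed (simp_all add: iatoms_isub, blast+)
qed

lemma ieval_symsub:
  "ieval I A (symsub \<theta> x) = (case x of Symbol a \<Rightarrow> ieval I A (ival \<theta> a) | _ \<Rightarrow> I x)"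
  by (simp add: symsub_def split: atom.split)

lemma ieval_parsub:
  "ieval I A (parsub f x) = (case x of Param k \<Rightarrow> ieval I A (f k) | _ \<Rightarrow> I x)"
  by (simp add: parsub_def split: atom.split)

lemma ieval_kappa_inst:
  "ieval I A (ival (kappa_inst e \<theta>) a) = ieval (I(Param 0 := ieval I A e)) A (ival \<theta> a)"
  by (auto simp: kappa_inst_def mem_parsub_def ieval_isub ieval_parsub
      intro!: ieval_cong split: atom.split)

lemma Param_in_kappa_inst:
  assumes "Param k \<in> iatoms (ival (kappa_inst e \<theta>) a)"
  shows "Param k \<in> iatoms e \<or> Param k \<in> iatoms (ival \<theta> a)"
proof -
  obtain x where "x \<in> iatoms (ival \<theta> a)"
    "Param k \<in> iatoms (parsub (\<lambda>j. if j = 0 then e else Atom (Param j)) x)"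
    using assms by (auto simp: kappa_inst_def mem_parsub_def iatoms_isub)
  then show ?thesis by (cases x rule: atom.exhaust) (auto simp: parsub_def split: if_splits)
qed

lemma state_simps [simp]:
  "loc (state l \<theta> \<phi>) = l" "mem (state l \<theta> \<phi>) = \<theta>" "pc (state l \<theta> \<phi>) = \<phi>"
  by (simp_all add: state_def)

section \<open>Paths\<close>

text \<open>The value 0 off the symbols is a dummy: instructions of a well-formed program contain no
  parameters and no indices.\<close>

definition sym_env :: "('v \<Rightarrow> int) \<Rightarrow> 'v atom \<Rightarrow> int" where
  "sym_env \<sigma> x = (case x of Symbol a \<Rightarrow> \<sigma> a | _ \<Rightarrow> 0)"

definition post ::
  "('l, 'v, 'w) program \<Rightarrow> 'l \<times> 'l \<Rightarrow> ('w \<Rightarrow> int \<Rightarrow> int) \<Rightarrow> ('v \<Rightarrow> int) \<Rightarrow> 'v \<Rightarrow> int" where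
  "post P ed A \<sigma> =
     (case instr P ed of Assign a E \<Rightarrow> \<sigma>(a := ieval (sym_env \<sigma>) A E) | Assume \<gamma> \<Rightarrow> \<sigma>)"

definition guard ::
  "('l, 'v, 'w) program \<Rightarrow> 'l \<times> 'l \<Rightarrow> ('w \<Rightarrow> int \<Rightarrow> int) \<Rightarrow> ('v \<Rightarrow> int) \<Rightarrow> bool" where
  "guard P ed A \<sigma> = (case instr P ed of Assign a E \<Rightarrow> True | Assume \<gamma> \<Rightarrow> beval (sym_env \<sigma>) A \<gamma>)"

text \<open>A path is given by its first location and the list of the locations after it.\<close>

primrec run ::
  "('l, 'v, 'w) program \<Rightarrow> 'l \<Rightarrow> 'l list \<Rightarrow> ('w \<Rightarrow> int \<Rightarrow> int) \<Rightarrow> ('v \<Rightarrow> int) \<Rightarrow> 'v \<Rightarrow> int" where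
  "run P l [] A \<sigma> = \<sigma>"
| "run P l (x # xs) A \<sigma> = run P x xs A (post P (l, x) A \<sigma>)"

primrec feasible ::
  "('l, 'v, 'w) program \<Rightarrow> 'l \<Rightarrow> 'l list \<Rightarrow> ('w \<Rightarrow> int \<Rightarrow> int) \<Rightarrow> ('v \<Rightarrow> int) \<Rightarrow> bool" where
  "feasible P l [] A \<sigma> \<longleftrightarrow> True"
| "feasible P l (x # xs) A \<sigma> \<longleftrightarrow> guard P (l, x) A \<sigma> \<and> feasible P x xs A (post P (l, x) A \<sigma>)"

primrec walk :: "('l, 'v, 'w) program \<Rightarrow> 'l \<Rightarrow> 'l list \<Rightarrow> bool" where
  "walk P l [] \<longleftrightarrow> True"
| "walk P l (x # xs) \<longleftrightarrow> (l, x) \<in> edges P \<and> walk P x xs"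

lemma run_append: "run P l (xs @ ys) A \<sigma> = run P (last (l # xs)) ys A (run P l xs A \<sigma>)"
  by (induction xs arbitrary: l \<sigma>) simp_all

lemma feasible_append:
  "feasible P l (xs @ ys) A \<sigma> \<longleftrightarrow>
     feasible P l xs A \<sigma> \<and> feasible P (last (l # xs)) ys A (run P l xs A \<sigma>)"
  by (induction xs arbitrary: l \<sigma>) simp_all

lemma walk_append: "walk P l (xs @ ys) \<longleftrightarrow> walk P l xs \<and> walk P (last (l # xs)) ys"
  by (induction xs arbitrary: l) simp_all

section \<open>Repeating a closed path\<close>

lemma last_loop:
  assumes "last (l # xs) = l"
  shows "last (l # concat (replicate n xs)) = l"
  using assms by (induction n) (auto simp: last_append)

lemma run_loop:
  assumes "last (l # xs) = l"
  shows "run P l (concat (replicate n xs)) A \<sigma> = (run P l xs A ^^ n) \<sigma>"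
proof (induction n arbitrary: \<sigma>)
  case (Suc n)
  have "run P l (concat (replicate (Suc n) xs)) A \<sigma> =
      run P (last (l # xs)) (concat (replicate n xs)) A (run P l xs A \<sigma>)"
    by (simp only: replicate_Suc concat.simps run_append)
  \<comment> \<open>The round peeled off is the first one, hence the innermost factor of the
    power.\<close>
  also have "\<dots> = (run P l xs A ^^ Suc n) \<sigma>"
    by (simp only: assms Suc funpow_Suc_right comp_apply)
  finally show ?case .
qed simp

text \<open>The right-hand side has the shape of the bounded quantifier in \<open>cycle_pc\<close>:
  the condition of one round is asked at the start of each of the \<open>n\<close> rounds.\<close>

lemma feasible_loop:
  assumes "last (l # xs) = l"
  shows "feasible P l (concat (replicate n xs)) A \<sigma> \<longleftrightarrow>
    (\<forall>j<n. feasible P l xs A ((run P l xs A ^^ j) \<sigma>))"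
proof (induction n arbitrary: \<sigma>)
  case (Suc n)
  have "feasible P l (concat (replicate (Suc n) xs)) A \<sigma> \<longleftrightarrow>
      feasible P l xs A \<sigma> \<and> feasible P (last (l # xs)) (concat (replicate n xs)) A (run P l xs A \<sigma>)"
    by (simp only: replicate_Suc concat.simps feasible_append)
  also have "\<dots> \<longleftrightarrow> feasible P l xs A \<sigma> \<and>
      (\<forall>j<n. feasible P l xs A ((run P l xs A ^^ Suc j) \<sigma>))"
    by (simp only: assms Suc funpow_Suc_right comp_apply)
  also have "\<dots> \<longleftrightarrow> (\<forall>j<Suc n. feasible P l xs A ((run P l xs A ^^ j) \<sigma>))"
    by (simp only: All_less_Suc2 funpow_0)
  finally show ?case .
qed simp

lemma walk_loop:
  assumes "last (l # xs) = l" and "walk P l xs"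
  shows "walk P l (concat (replicate n xs))"
proof (induction n)
  case (Suc n)
  have "walk P l (concat (replicate (Suc n) xs)) \<longleftrightarrow>
      walk P l xs \<and> walk P (last (l # xs)) (concat (replicate n xs))"
    by (simp only: replicate_Suc concat.simps walk_append)
  with Suc assms show ?case by simp
qed simp

text \<open>Well-formed instructions assign to program variables only. This justifies the identity
  entries with which \<open>cycle_mem\<close> starts.\<close>

lemma run_outside:
  assumes "wf_program P" and "walk P l xs" and "a \<notin> ivars P"
  shows "run P l xs A \<sigma> a = \<sigma> a"
  using assms(2)
proof (induction xs arbitrary: l \<sigma>)
  case (Cons x xs)
  then have "wf_instr (ivars P) (avars P) (instr P (l, x))"
    using assms(1) by (auto simp: wf_program_def)
  with Cons assms(3) show ?case by (auto simp: post_def split: instr.split)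
qed simp

section \<open>States denoting paths\<close>

text \<open>
  The set \<open>K\<close> of environments fixes the parameters: it is \<open>UNIV\<close> for states without parameters and
  \<open>param_envs N\<close> for parameter values \<open>N\<close>.
\<close>

definition denotes ::
  "('l, 'v, 'w) program \<Rightarrow> ('v atom \<Rightarrow> int) set \<Rightarrow> 'l \<Rightarrow> 'l list \<Rightarrow> ('l, 'v, 'w) state \<Rightarrow> bool" where
  "denotes P K l xs s \<longleftrightarrow>
     loc s = last (l # xs) \<and> aval (mem s) = ASymbol \<and>
     (\<forall>I\<in>K. \<forall>A.
        (\<forall>a. ieval I A (ival (mem s) a) = run P l xs A (\<lambda>b. I (Symbol b)) a) \<and>
        (holds I A (pc s) \<longleftrightarrow> feasible P l xs A (\<lambda>b. I (Symbol b))))"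

definition param_envs :: "(nat \<Rightarrow> nat) \<Rightarrow> ('v atom \<Rightarrow> int) set" where
  "param_envs N = {I. \<forall>k. I (Param k) = int (N k)}"

lemma denotesD:
  assumes "denotes P K l xs s"
  shows "loc s = last (l # xs)" and "aval (mem s) = ASymbol"
    and "I \<in> K \<Longrightarrow> ieval I A (ival (mem s) a) = run P l xs A (\<lambda>b. I (Symbol b)) a"
    and "I \<in> K \<Longrightarrow> holds I A (pc s) \<longleftrightarrow> feasible P l xs A (\<lambda>b. I (Symbol b))"
  using assms by (auto simp: denotes_def)

lemma denotes_init: "denotes P K l [] (state l init_mem (Qf BTrue))"
  by (simp add: denotes_def init_mem_def)

lemma ieval_sym_env:
  fixes e :: "('v atom, 'w) iexp" and b :: "('v atom, 'w) bexp"
  shows "iatoms e \<subseteq> range Symbol \<Longrightarrow> ieval I A e = ieval (sym_env (\<lambda>a. I (Symbol a))) A e"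
    and "batoms b \<subseteq> range Symbol \<Longrightarrow> beval I A b = beval (sym_env (\<lambda>a. I (Symbol a))) A b"
  by (auto intro!: ieval_cong simp: sym_env_def)

lemma wf_instr_edge:
  assumes "wf_program P" and "(l, l') \<in> edges P"
  shows "wf_instr (ivars P) (avars P) (instr P (l, l'))"
  using assms by (auto simp: wf_program_def)

lemma step_edge: "step P s l' t \<Longrightarrow> (loc s, l') \<in> edges P"
  by (auto elim: step.cases)

text \<open>Isolates what one more edge requires, so that the three kinds of classic step only have
  to compare the new values and the new conjunct.\<close>

lemma denotes_snoc:
  assumes "denotes P K l xs s" and "loc t = l'" and "aval (mem t) = ASymbol"
    and "\<And>I A a. I \<in> K \<Longrightarrow>
      ieval I A (ival (mem t) a) = post P (loc s, l') A (run P l xs A (\<lambda>b. I (Symbol b))) a"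
    and "\<And>I A. I \<in> K \<Longrightarrow> holds I A (pc t) \<longleftrightarrow>
      holds I A (pc s) \<and> guard P (loc s, l') A (run P l xs A (\<lambda>b. I (Symbol b)))"
  shows "denotes P K l (xs @ [l']) t"
  unfolding denotes_def run_append feasible_append
  using assms(2-) denotesD(1,4)[OF assms(1)] by simp

lemma denotes_apply:
  assumes "denotes P K l xs s" and "I \<in> K"
  shows "iatoms E \<subseteq> range Symbol \<Longrightarrow> ieval I A (iapply (mem s) E) =
      ieval (sym_env (run P l xs A (\<lambda>b. I (Symbol b)))) A E"
    and "batoms \<gamma> \<subseteq> range Symbol \<Longrightarrow> beval I A (bapply (mem s) \<gamma>) =
      beval (sym_env (run P l xs A (\<lambda>b. I (Symbol b)))) A \<gamma>"
proof -
  \<comment> \<open>Applying the memory of \<open>s\<close> amounts to evaluating with the values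
    after \<open>xs\<close>.\<close>
  have env: "(\<lambda>b. ieval I A (symsub (mem s) (Symbol b))) = run P l xs A (\<lambda>b. I (Symbol b))"
    using denotesD(3)[OF assms] by (simp add: ieval_symsub)
  note sym = ieval_sym_env[where I = "\<lambda>x. ieval I A (symsub (mem s) x)", unfolded env]
  show "iatoms E \<subseteq> range Symbol \<Longrightarrow> ieval I A (iapply (mem s) E) =
      ieval (sym_env (run P l xs A (\<lambda>b. I (Symbol b)))) A E"
    and "batoms \<gamma> \<subseteq> range Symbol \<Longrightarrow> beval I A (bapply (mem s) \<gamma>) =
      beval (sym_env (run P l xs A (\<lambda>b. I (Symbol b)))) A \<gamma>"
    using sym by (simp_all add: iapply_def bapply_def ieval_isub denotesD(2)[OF assms(1)])
qed

lemma denotes_step: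
  assumes wf: "wf_program P" and den: "denotes P K l xs s" and st: "step P s l' t"
  shows "denotes P K l (xs @ [l']) t"
  using st
proof cases
  case (assign l1 a E \<theta> \<phi>)
  have "iatoms E \<subseteq> range Symbol"
    using wf_instr_edge[OF wf assign(3)] assign(4) by auto
  then show ?thesis
    using assign denotesD(2,3)[OF den] denotes_apply(1)[OF den]
    by (intro denotes_snoc[OF den]) (simp_all add: post_def guard_def)
next
  case (condition l1 \<gamma> \<theta> \<phi>)
  have "batoms \<gamma> \<subseteq> range Symbol"
    using wf_instr_edge[OF wf condition(3)] condition(4) by auto
  then show ?thesis
    using condition denotesD(2,3)[OF den] denotes_apply(2)[OF den]
    by (intro denotes_snoc[OF den]) (simp_all add: post_def guard_def)
next
  case (implied_condition l1 \<gamma> \<phi> \<theta>)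
  have atoms: "batoms \<gamma> \<subseteq> range Symbol"
    using wf_instr_edge[OF wf implied_condition(3)] implied_condition(4) by auto
  \<comment> \<open>The omitted conjunct follows from the path condition, so the guard holds
    wherever \<open>s\<close> is feasible.\<close>
  have "guard P (loc s, l') A (run P l xs A (\<lambda>b. I (Symbol b)))"
    if "I \<in> K" "holds I A (pc s)" for I A
    using that implied_condition denotes_apply(2)[OF den that(1) atoms, of A]
    by (simp add: implies_def guard_def)
  then show ?thesis
    using implied_condition denotesD(2,3)[OF den]
    by (intro denotes_snoc[OF den]) (auto simp: post_def)
qed

lemma state_params_step:
  assumes wf: "wf_program P" and st: "step P s l' t"
  shows "state_params t \<subseteq> state_params s"
  using st
proof cases
  case (assign l a E \<theta> \<phi>)
  have "iatoms E \<subseteq> range Symbol"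
    using wf_instr_edge[OF wf assign(3)] assign(4) by auto
  then have "\<exists>b. Param k \<in> iatoms (ival \<theta> b)" if "Param k \<in> iatoms (iapply \<theta> E)" for k
    using that by (fastforce simp: iapply_def iatoms_isub symsub_def)
  then show ?thesis
    using assign by (auto simp: state_params_def split: if_splits)
next
  case (condition l \<gamma> \<theta> \<phi>)
  have "batoms \<gamma> \<subseteq> range Symbol"
    using wf_instr_edge[OF wf condition(3)] condition(4) by auto
  then have "\<exists>b. Param k \<in> iatoms (ival \<theta> b)" if "Param k \<in> batoms (bapply \<theta> \<gamma>)" for k
    using that by (fastforce simp: bapply_def iatoms_isub symsub_def)
  then show ?thesis
    using condition by (auto simp: state_params_def)
next
  case (implied_condition l \<gamma> \<phi> \<theta>)
  then show ?thesis by (auto simp: state_params_def)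
qed

lemma pc_step: "step P s l' t \<Longrightarrow> holds I A (pc t) \<Longrightarrow> holds I A (pc s)"
  by (auto elim: step.cases)

text \<open>Path execution starts without parameters and no instruction introduces any, so the
  denotation does not depend on their values.\<close>

lemma exec_path_denotes:
  assumes wf: "wf_program P" and "exec_path P \<rho> t"
  shows "\<rho> \<noteq> [] \<and> walk P (hd \<rho>) (tl \<rho>) \<and> denotes P UNIV (hd \<rho>) (tl \<rho>) t \<and> state_params t = {}"
  using assms(2)
proof induction
  case (start l)
  then show ?case
    by (simp add: denotes_init) (auto simp: state_params_def init_mem_def)
next
  case (extend \<rho> s l' s')
  then show ?case
    using denotes_step[OF wf _ extend(2)] step_edge[OF extend(2)] state_params_step[OF wf extend(2)]
    by (auto simp: walk_append dest: denotesD(1))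
qed

section \<open>Templates\<close>

text \<open>Each rule solves a recurrence: adding \<open>c\<close> gives a linear term, multiplying
  by \<open>c\<close> a power, and a derived variable after n+1 rounds is \<open>g\<close> at the
  state after n rounds, whose entries are right by induction. The environment is arbitrary because
  this last case lowers \<open>Param 0\<close> by one.\<close>

lemma cycle_mem_values:
  assumes wf: "wf_program P" and "cycle_mem P \<theta> m"
    and den: "denotes P UNIV l xs (state l \<theta> \<phi>)" and walk: "walk P l xs"
    and "m a = Some e" and "0 \<le> I (Param 0)"
  shows "ieval I A e = (run P l xs A ^^ nat (I (Param 0))) (\<lambda>b. I (Symbol b)) a"
  using assms(2,5,6)
proof (induction arbitrary: a e I)
  case init
  have "(run P l xs A ^^ n) \<sigma> a = \<sigma> a" for n \<sigma>
    by (induction n) (use init run_outside[OF wf walk] in \<open>auto split: if_splits\<close>)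
  with init show ?case by (auto split: if_splits)
next
  case (add_const m a' c)
  have body: "run P l xs A \<sigma> a' = \<sigma> a' + c" for \<sigma>
    using denotesD(3)[OF den, of "sym_env \<sigma>" A a'] add_const(4)
    by (simp add: expr_equiv_def sym_env_def)
  have "(run P l xs A ^^ n) \<sigma> a' = \<sigma> a' + int n * c" for n \<sigma>
    by (induction n) (simp_all add: body algebra_simps)
  with add_const show ?case by (auto split: if_splits)
next
  case (mul_const m a' c)
  have body: "run P l xs A \<sigma> a' = \<sigma> a' * c" for \<sigma>
    using denotesD(3)[OF den, of "sym_env \<sigma>" A a'] mul_const(4)
    by (simp add: expr_equiv_def sym_env_def)
  have "(run P l xs A ^^ n) \<sigma> a' = \<sigma> a' * c ^ n" for n \<sigma>
    by (induction n) (simp_all add: body algebra_simps)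
  with mul_const show ?case by (auto split: if_splits)
next
  case (derived m a' g)
  show ?case
  proof (cases "a = a'")
    case False
    with derived show ?thesis by simp
  next
    case True
    show ?thesis
    proof (cases "I (Param 0) = 0")
      \<comment> \<open>After no round the \<open>Ite\<close> selects the initial value;
        \<open>Param 0\<close> minus one would be negative here.\<close>
      case zero: True
      with True derived show ?thesis by auto
    next
      case False
      \<comment> \<open>\<open>?J\<close> evaluates the earlier entries one round before the end;
        their values there form the state \<open>\<sigma>\<close>.\<close>
      let ?J = "I(Param 0 := I (Param 0) - 1)"
      define n where "n = nat (I (Param 0) - 1)"
      define \<sigma> where "\<sigma> = (run P l xs A ^^ n) (\<lambda>b. I (Symbol b))"
      have n: "nat (I (Param 0)) = Suc n" "0 < I (Param 0)"
        using False derived.prems(2) by (auto simp: n_def)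
      have "ieval I A (iapply (kappa_inst (Sub kappa (Const 1)) (mem_of m)) g) =
          ieval (sym_env \<sigma>) A g"
      proof -
        have "ieval I A (symsub (kappa_inst (Sub kappa (Const 1)) (mem_of m)) x) = sym_env \<sigma> x"
          if x: "x \<in> iatoms g" for x
        proof -
          obtain b e where b: "x = Symbol b" "m b = Some e" using x derived(5) by blast
          have "ieval ?J A e = (run P l xs A ^^ nat (?J (Param 0))) (\<lambda>b. ?J (Symbol b)) b"
            by (rule derived.IH) (use b n in auto)
          then show ?thesis
            using b by (simp add: ieval_symsub ieval_kappa_inst mem_of_def sym_env_def \<sigma>_def n_def)
        qed
        then show ?thesis
          by (auto simp: iapply_def ieval_isub kappa_inst_def mem_parsub_def mem_of_def
              intro!: ieval_cong)
      qed
      also have "\<dots> = run P l xs A \<sigma> a'"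
        using denotesD(3)[OF den, of "sym_env \<sigma>" A a'] derived(4)
        by (simp add: expr_equiv_def sym_env_def)
      finally show ?thesis
        using True derived.prems(1) n by (auto simp: \<sigma>_def)
    qed
  qed
qed

text \<open>Hence renaming \<open>Param 0\<close> accounts for every parameter that a template
  brings in.\<close>

lemma cycle_mem_params:
  assumes "cycle_mem P \<theta> m" and "m a = Some e" and "Param k \<in> iatoms e"
  shows "k = 0"
  using assms
proof (induction arbitrary: a e)
  case (derived m a' g)
  show ?case
  proof (cases "a = a'")
    case False
    with derived show ?thesis by simp
  next
    case True
    have "k = 0"
      if k: "Param k \<in> iatoms (iapply (kappa_inst (Sub kappa (Const 1)) (mem_of m)) g)"
    proof -
      obtain x where x: "x \<in> iatoms g"
        "Param k \<in> iatoms (symsub (kappa_inst (Sub kappa (Const 1)) (mem_of m)) x)"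
        using k by (auto simp: iapply_def iatoms_isub)
      then obtain b e where b: "x = Symbol b" "m b = Some e" using derived(5) by blast
      with x show ?thesis
        using derived.IH[OF b(2)]
        by (auto simp: symsub_def mem_of_def dest!: Param_in_kappa_inst)
    qed
    with True derived show ?thesis by auto
  qed
qed (auto split: if_splits)

section \<open>Parameters of composed states and of template results\<close>

lemma state_params_comp: "state_params (state_comp s t) \<subseteq> state_params s \<union> state_params t"
proof
  fix k assume k: "k \<in> state_params (state_comp s t)"
  have sym: "k \<in> state_params s \<or> x = Param k" if "Param k \<in> iatoms (symsub (mem s) x)" for x
    using that by (auto simp: symsub_def state_params_def split: atom.splits)
  show "k \<in> state_params s \<union> state_params t"
  proof (cases "Param k \<in> fatoms (fapply (mem s) (pc t))")
    case True
    then obtain x where "x \<in> fatoms (pc t)" "Param k \<in> iatoms (symsub (mem s) x)"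
      using Param_in_fatoms_fsub[OF True[unfolded fapply_def]] by (auto simp: symsub_def)
    with sym show ?thesis by (auto simp: state_params_def)
  next
    case False
    with k show ?thesis
      using sym
      by (auto simp: state_params_def state_comp_def mem_comp_def iapply_def iatoms_isub)
  qed
qed

lemma state_params_rename_kappa:
  assumes "state_params t \<subseteq> {0}"
  shows "state_params (rename_kappa k t) \<subseteq> {k}"
proof
  fix j assume j: "j \<in> state_params (rename_kappa k t)"
  let ?f = "parsub (\<lambda>j. Atom (Param (if j = 0 then k else j))) :: _ \<Rightarrow> ('b, 'c) expr"
  have par: "\<exists>i. x = Param i \<and> j = (if i = 0 then k else i)" if "Param j \<in> iatoms (?f x)" for x
    using that by (cases x rule: atom.exhaust) (simp_all add: parsub_def)
  have "\<exists>i\<in>state_params t. j = (if i = 0 then k else i)"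
  proof (cases "Param j \<in> fatoms (fsub ?f ASymbol (pc t))")
    case True
    then obtain x where "x \<in> fatoms (pc t)" "Param j \<in> iatoms (?f x)"
      using Param_in_fatoms_fsub[OF True] by (auto simp: parsub_def)
    then show ?thesis using par unfolding state_params_def by blast
  next
    case False
    with j obtain a where "Param j \<in> iatoms (isub ?f ASymbol (ival (mem t) a))"
      by (auto simp: state_params_def rename_kappa_def state_parsub_def mem_parsub_def)
    then obtain x where "x \<in> iatoms (ival (mem t) a)" "Param j \<in> iatoms (?f x)"
      by (auto simp: iatoms_isub)
    then show ?thesis using par unfolding state_params_def by blast
  qed
  with assms show "j \<in> {k}" by auto
qed

lemma state_params_cycle:
  assumes cm: "cycle_mem P \<theta> m" and \<phi>: "\<And>k. Param k \<notin> fatoms \<phi>"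
  shows "state_params (state e (mem_of m) (cycle_pc (mem_of m) \<phi>)) \<subseteq> {0}"
proof -
  have mem: "k = 0" if "Param k \<in> iatoms (ival (mem_of m) a)" for k a
    using that cycle_mem_params[OF cm] by (auto simp: mem_of_def split: option.splits)
  have "k = 0"
    if k: "Param k \<in> fatoms (fapply (kappa_inst (Atom (Bound 0)) (mem_of m)) \<phi>)" for k
  proof -
    obtain x where x: "x \<in> fatoms \<phi>"
      "Param k \<in> iatoms (symsub (kappa_inst (Atom (Bound 0)) (mem_of m)) x)"
      using Param_in_fatoms_fsub[OF k[unfolded fapply_def]] by (auto simp: symsub_def)
    with \<phi> obtain a where "Param k \<in> iatoms (ival (kappa_inst (Atom (Bound 0)) (mem_of m)) a)"
      by (auto simp: symsub_def split: atom.splits)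
    then show ?thesis
      using mem
      by (auto dest!: Param_in_kappa_inst)
  qed
  then show ?thesis
    using mem by (auto simp: state_params_def cycle_pc_def)
qed

text \<open>With the quantified number of rounds substituted, the memory yields the state after that
  many rounds, where \<open>\<phi>\<close> says that one more round is feasible. The quantifier then
  matches \<open>feasible_loop\<close>.\<close>

lemma holds_cycle_pc:
  assumes wf: "wf_program P" and cm: "cycle_mem P \<theta> m" and total: "\<forall>a. m a \<noteq> None"
    and den: "denotes P UNIV l xs (state l \<theta> \<phi>)" and walk: "walk P l xs"
    and loop: "last (l # xs) = l" and I: "I (Param 0) = int n"
  shows "holds I A (cycle_pc (mem_of m) \<phi>) \<longleftrightarrow>
    feasible P l (concat (replicate n xs)) A (\<lambda>b. I (Symbol b))"
proof -
  \<comment> \<open>The closed forms are justified for a non-negative number of rounds; the premise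
    of the quantified implication supplies this.\<close>
  have body: "holds (bind z I) A (fapply (kappa_inst (Atom (Bound 0)) (mem_of m)) \<phi>) \<longleftrightarrow>
      feasible P l xs A ((run P l xs A ^^ nat z) (\<lambda>b. I (Symbol b)))" if "0 \<le> z" for z
  proof -
    have "ieval (bind z I) A (ival (kappa_inst (Atom (Bound 0)) (mem_of m)) a) =
        (run P l xs A ^^ nat z) (\<lambda>b. I (Symbol b)) a" for a
    proof -
      obtain e where e: "m a = Some e" using total by auto
      \<comment> \<open>Under \<open>bind z I\<close> the index substituted for
        \<open>Param 0\<close> has value \<open>z\<close>, so the substitution becomes an update of
        the environment.\<close>
      have "ieval ((bind z I)(Param 0 := z)) A e =
          (run P l xs A ^^ nat z) (\<lambda>b. I (Symbol b)) a"
        using cycle_mem_values[OF wf cm den walk e, of "(bind z I)(Param 0 := z)"] that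
        by (simp add: bind_def)
      then show ?thesis
        using e by (simp add: ieval_kappa_inst mem_of_def bind_def)
    qed
    then show ?thesis
      using denotesD(4)[OF den]
      by (simp add: fapply_def holds_fsub ieval_symsub kappa_inst_def mem_parsub_def mem_of_def)
  qed
  have "holds I A (cycle_pc (mem_of m) \<phi>) \<longleftrightarrow>
      (\<forall>z. 0 \<le> z \<and> z < int n \<longrightarrow>
        feasible P l xs A ((run P l xs A ^^ nat z) (\<lambda>b. I (Symbol b))))"
    using body I by (auto simp: cycle_pc_def bind_def)
  also have "\<dots> \<longleftrightarrow> (\<forall>j<n. feasible P l xs A ((run P l xs A ^^ j) (\<lambda>b. I (Symbol b))))"
    by (metis nat_int nat_less_iff of_nat_0_le_iff of_nat_less_iff)
  finally show ?thesis by (simp add: feasible_loop[OF loop])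
qed

text \<open>Collects what the tree arguments use about template results. The path is chosen after
  \<open>n\<close> but before the environment, so a value of the parameter fixes one path for all
  initial values.\<close>

definition template_state_for ::
  "('l, 'v, 'w) program \<Rightarrow> 'l \<Rightarrow> ('l, 'v, 'w) state \<Rightarrow> bool" where
  "template_state_for P l t \<longleftrightarrow>
     state_params t \<subseteq> {0} \<and> aval (mem t) = ASymbol \<and>
     (\<forall>I A. holds I A (pc t) \<longrightarrow> 0 \<le> I (Param 0)) \<and>
     (\<forall>n. \<exists>ys. walk P l ys \<and> denotes P {I. I (Param 0) = int n} l ys t)"

text \<open>The path for \<open>n\<close> is \<open>n\<close> rounds of the core, followed by the
  way to the exit edge.\<close>

lemma template_alg_states:
  assumes wf: "wf_program P" and cyc: "is_cycle P \<pi> e X"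
    and alg: "template_alg P sat \<pi> e X (e', M)" and t: "t \<in> M"
  shows "e' = e \<and> template_state_for P e t"
  using alg
proof cases
  case (success \<theta> \<phi> m r)
  obtain u x where ed: "(u, x) \<in> X" and t_eq:
    "t = state_comp (state e (mem_of m) (cycle_pc (mem_of m) \<phi>)) (r (u, x))"
    using t success by auto
  obtain \<omega> where \<pi>: "\<pi> = e # \<omega> @ [e]" using cyc by (auto simp: is_cycle_def)
  define xs where "xs = \<omega> @ [e]"
  define zs where "zs = tl (prefix_to u \<pi> @ [x])"
  \<comment> \<open>This includes \<open>u = e\<close>, where \<open>takeWhile\<close> returns the
    empty list.\<close>
  have hd: "hd (prefix_to u \<pi> @ [x]) = e"
    using \<pi> by (auto simp: prefix_to_def)
  have loop: "last (e # xs) = e" by (simp add: xs_def)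
  have cycle: "walk P e xs" "denotes P UNIV e xs (state e \<theta> \<phi>)" "state_params (state e \<theta> \<phi>) = {}"
    using exec_path_denotes[OF wf success(2)] \<pi> by (simp_all add: xs_def)
  have "exec_path P (prefix_to u \<pi> @ [x]) (r (u, x))" using success(6) ed by auto
  from exec_path_denotes[OF wf this]
  have exit: "walk P e zs" "denotes P UNIV e zs (r (u, x))" "state_params (r (u, x)) = {}"
    by (simp_all add: hd zs_def)
  have "state_params (state e (mem_of m) (cycle_pc (mem_of m) \<phi>)) \<subseteq> {0}"
    using cycle(3) by (intro state_params_cycle[OF success(4)]) (auto simp: state_params_def)
  then have params: "state_params t \<subseteq> {0}"
    using state_params_comp exit(3) unfolding t_eq by blast
  have nonneg: "0 \<le> I (Param 0)" if "holds I A (pc t)" for I A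
    using that by (simp add: t_eq state_comp_def cycle_pc_def)
  have av: "aval (mem_of m) = ASymbol" by (simp add: mem_of_def)
  have "walk P e (concat (replicate n xs) @ zs)" for n
    using last_loop[OF loop, of n] walk_loop[OF loop cycle(1)] exit(1)
    by (simp add: walk_append)
  moreover have "denotes P {I. I (Param 0) = int n} e (concat (replicate n xs) @ zs) t" for n
  proof -
    have main: "ieval I A (ival (mem t) a) =
          run P e (concat (replicate n xs) @ zs) A (\<lambda>b. I (Symbol b)) a \<and>
        (holds I A (pc t) \<longleftrightarrow>
          feasible P e (concat (replicate n xs) @ zs) A (\<lambda>b. I (Symbol b)))"
      if I: "I (Param 0) = int n" for I A a
    proof -
      have iter: "ieval I A (ival (mem_of m) b) = (run P e xs A ^^ n) (\<lambda>b. I (Symbol b)) b" for b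
      proof -
        obtain e' where e': "m b = Some e'" using success(5) by auto
        then show ?thesis
          using cycle_mem_values[OF wf success(4) cycle(2,1) e'] I by (simp add: mem_of_def)
      qed
      show ?thesis
        using denotesD(3,4)[OF exit(2)] last_loop[OF loop, of n]
          holds_cycle_pc[OF wf success(4,5) cycle(2,1) loop, of I n A] I
        by (simp add: t_eq state_comp_def mem_comp_def iapply_def fapply_def ieval_isub holds_fsub
            ieval_symsub av iter run_append feasible_append run_loop[OF loop])
    qed
    have "loc t = last (e # concat (replicate n xs) @ zs)"
      using denotesD(1)[OF exit(2)] last_loop[OF loop, of n]
      by (auto simp: t_eq state_comp_def last_append split: if_splits)
    moreover have "aval (mem t) = ASymbol"
      using denotesD(2)[OF exit(2)] by (simp add: t_eq state_comp_def mem_comp_def av)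
    ultimately show ?thesis using main by (auto simp: denotes_def)
  qed
  moreover have "aval (mem t) = ASymbol"
    using denotesD(2)[OF exit(2)] by (simp add: t_eq state_comp_def mem_comp_def av)
  ultimately show ?thesis
    using success(1) params nonneg unfolding template_state_for_def by blast
qed

text \<open>Composition of states is concatenation of paths; the value of \<open>N\<close> at the
  renamed parameter \<open>k\<close> selects the number of rounds.\<close>

lemma denotes_template:
  assumes den: "denotes P (param_envs N) l xs s" and walk: "walk P l xs"
    and t: "template_state_for P (loc s) t"
  shows "\<exists>ys. walk P l ys \<and> denotes P (param_envs N) l ys (state_comp s (rename_kappa k t))"
proof -
  obtain ys where ys: "walk P (loc s) ys" "denotes P {I. I (Param 0) = int (N k)} (loc s) ys t"
    using t unfolding template_state_for_def by blast
  have loc: "loc s = last (l # xs)" and av: "aval (mem s) = ASymbol"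
    using denotesD[OF den] by auto
  have main: "ieval I A (ival (mem (state_comp s (rename_kappa k t))) a) =
        run P l (xs @ ys) A (\<lambda>b. I (Symbol b)) a \<and>
      (holds I A (pc (state_comp s (rename_kappa k t))) \<longleftrightarrow>
        feasible P l (xs @ ys) A (\<lambda>b. I (Symbol b)))"
    if I: "I \<in> param_envs N" for I A a
  proof -
    \<comment> \<open>The environment in which \<open>t\<close> is evaluated inside the composition:
      symbols have their values after \<open>xs\<close>, and \<open>Param 0\<close> has the value of
      \<open>k\<close>.\<close>
    define J where "J x = (case x of Symbol b \<Rightarrow> run P l xs A (\<lambda>b. I (Symbol b)) b
      | Param j \<Rightarrow> I (Param (if j = 0 then k else j)) | Bound _ \<Rightarrow> I x)" for x
    have env: "(\<lambda>x. ieval (\<lambda>x. ieval I A (symsub (mem s) x)) A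
        (parsub (\<lambda>j. Atom (Param (if j = 0 then k else j))) x)) = J"
      by (rule ext)
        (simp add: J_def ieval_symsub ieval_parsub denotesD(3)[OF den I] split: atom.split)
    have "J (Param 0) = int (N k)" "(\<lambda>b. J (Symbol b)) = run P l xs A (\<lambda>b. I (Symbol b))"
      using I by (simp_all add: J_def param_envs_def)
    then show ?thesis
      using denotesD(3,4)[OF ys(2), of J] denotesD(4)[OF den I]
      by (simp add: state_comp_def mem_comp_def rename_kappa_def state_parsub_def mem_parsub_def
          iapply_def fapply_def ieval_isub holds_fsub av env run_append feasible_append loc)
  qed
  have "loc (state_comp s (rename_kappa k t)) = last (l # xs @ ys)"
    using denotesD(1)[OF ys(2)] loc
    by (auto simp: state_comp_def rename_kappa_def state_parsub_def last_append split: if_splits)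
  moreover have "aval (mem (state_comp s (rename_kappa k t))) = ASymbol"
    using denotesD(2)[OF ys(2)] av
    by (simp add: state_comp_def mem_comp_def rename_kappa_def state_parsub_def mem_parsub_def)
  ultimately have "denotes P (param_envs N) l (xs @ ys) (state_comp s (rename_kappa k t))"
    using main by (auto simp: denotes_def)
  moreover have "walk P l (xs @ ys)" using walk ys(1) loc by (simp add: walk_append)
  ultimately show ?thesis by blast
qed

section \<open>Trees\<close>

lemma grown_child:
  assumes "grown P sat expn u" and "c \<in> fset (children u)" and "\<forall>\<phi>. sat \<phi> \<noteq> UNKNOWN"
  shows "grown P sat expn c \<and> sat (pc (label c)) = SAT \<and>
    (\<exists>S. expn (label u) (applied u) S \<and> label c \<in> S)"
  using assms(1)
proof cases
  case (final s)
  with assms(2) show ?thesis by simp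
next
  case (expand s tmpl S C)
  have "label c \<in> {s' \<in> S. sat (pc s') \<noteq> UNSAT}"
    using assms(2) expand(1,5) by auto
  then have "label c \<in> S" "sat (pc (label c)) = SAT"
    using assms(3) by (auto intro: answer.exhaust)
  with expand assms(2) show ?thesis by auto
qed

text \<open>A feasible path is never pruned: its initial values satisfy the path condition of each
  successor along it, so the answer there cannot be UNSAT.\<close>

lemma classic_node:
  assumes wf: "wf_program P" and sat: "sat_function sat" and tree: "classic_tree P sat T"
    and total: "\<forall>\<phi>. sat \<phi> \<noteq> UNKNOWN"
    and "walk P (start P) xs" and "feasible P (start P) xs A \<sigma>"
  shows "\<exists>u\<in>nodes T. grown P sat (classic_expansion P) u \<and> denotes P UNIV (start P) xs (label u)"
  using assms(5,6)
proof (induction xs rule: rev_induct)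
  case Nil
  show ?case
    using tree nodes.root[of T]
    by (auto simp: classic_tree_def root_state_def denotes_init)
next
  case (snoc l' xs)
  then obtain u where u: "u \<in> nodes T" "grown P sat (classic_expansion P) u"
    "denotes P UNIV (start P) xs (label u)"
    by (auto simp: walk_append feasible_append)
  have edge: "(loc (label u), l') \<in> edges P"
    using snoc.prems(1) denotesD(1)[OF u(3)] by (simp add: walk_append)
  show ?case
    using u(2)
  proof cases
    case (final s)
    with edge wf show ?thesis by (auto simp: wf_program_def succs_def)
  next
    case (expand s tmpl S C)
    obtain f where f: "\<forall>l' \<in> succs P (loc s). step P s l' (f l')" "S = f ` succs P (loc s)"
      using expand(3) by (auto simp: classic_expansion_def)
    have l': "l' \<in> succs P (loc s)" using edge expand(1) by (simp add: succs_def)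
    with f have "step P (label u) l' (f l')" using expand(1) by simp
    note den = denotes_step[OF wf u(3) this]
    have "holds (sym_env \<sigma>) A (pc (f l'))"
      using denotesD(4)[OF den, of "sym_env \<sigma>"] snoc.prems(2) by (simp add: sym_env_def)
    then have "sat (pc (f l')) \<noteq> UNSAT"
      using sat by (auto simp: sat_function_def satisfiable_def)
    then have "f l' \<in> label ` fset C" using expand(5) f(2) l' by simp
    then obtain c where c: "c \<in> fset (children u)" "label c = f l'" using expand(1) by auto
    then show ?thesis
      using den grown_child[OF u(2) c(1) total] nodes.child[OF u(1) c(1)] by auto
  qed
qed

text \<open>
  \<open>G\<close> collects the parameters introduced so far. It bounds the parameters of a state uniformly, as
  \<open>state_params\<close> also ranges over names that are not variables of the program.
\<close>

definition guarded_params :: "nat set \<Rightarrow> ('l, 'v, 'w) state \<Rightarrow> bool" where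
  "guarded_params G s \<longleftrightarrow>
     finite G \<and> state_params s \<subseteq> G \<and>
     (\<forall>k\<in>G. \<forall>I A. holds I A (pc s) \<longrightarrow> 0 \<le> I (Param k))"

text \<open>The new parameter is bounded by the path condition of \<open>t\<close>, the old ones by
  that of \<open>s\<close>, which remains a conjunct.\<close>

lemma guarded_params_template:
  assumes "guarded_params G s" and t: "template_state_for P l t"
  shows "guarded_params (insert k G) (state_comp s (rename_kappa k t))"
proof -
  have "state_params (state_comp s (rename_kappa k t)) \<subseteq> insert k G"
    using state_params_comp[of s "rename_kappa k t"] state_params_rename_kappa[of t k] assms
    by (auto simp: guarded_params_def template_state_for_def)
  moreover have "0 \<le> I (Param k)" if "holds I A (pc (state_comp s (rename_kappa k t)))" for I A
  proof -
    have "\<exists>J B. holds J B (pc t) \<and> J (Param 0) = I (Param k)"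
      using that
      by (auto simp: state_comp_def rename_kappa_def state_parsub_def fapply_def holds_fsub
          ieval_symsub ieval_parsub intro!: exI)
    then show ?thesis using t by (metis template_state_for_def)
  qed
  moreover have "holds I A (pc s)" if "holds I A (pc (state_comp s (rename_kappa k t)))" for I A
    using that by (simp add: state_comp_def)
  ultimately show ?thesis
    using assms(1) unfolding guarded_params_def by blast
qed

text \<open>A node stands for a family of paths, so \<open>xs\<close> depends on \<open>N\<close>.
  Satisfiability and the guarded parameters later provide one suitable \<open>N\<close>.\<close>

lemma compact_node:
  assumes wf: "wf_program P" and sat: "sat_function sat" and tree: "compact_tree P sat p T"
    and total: "\<forall>\<phi>. sat \<phi> \<noteq> UNKNOWN"
    and templates: "\<forall>(l, M)\<in>p. \<forall>t\<in>M. template_state_for P l t"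
    and "u \<in> nodes T"
  shows "grown P sat (compact_expansion P p) u \<and> satisfiable (pc (label u)) \<and>
    (\<exists>G. guarded_params G (label u)) \<and>
    (\<forall>N. \<exists>xs. walk P (start P) xs \<and> denotes P (param_envs N) (start P) xs (label u))"
  using assms(6)
proof induction
  case root
  have "guarded_params {} (root_state P)"
    by (auto simp: guarded_params_def root_state_def state_params_def init_mem_def)
  moreover have "walk P (start P) [] \<and> denotes P K (start P) [] (root_state P)" for K
    by (simp add: root_state_def denotes_init)
  moreover have "satisfiable (pc (root_state P))"
    by (simp add: root_state_def satisfiable_def)
  ultimately show ?case
    using tree unfolding compact_tree_def by metis
next
  case (child u c)
  then obtain G where G: "guarded_params G (label u)" by blast
  obtain S where c: "grown P sat (compact_expansion P p) c" "sat (pc (label c)) = SAT"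
    and S: "compact_expansion P p (label u) (applied u) S" "label c \<in> S"
    using grown_child[OF _ child(2) total] child(3) by blast
  have "satisfiable (pc (label c))" using c(2) sat by (simp add: sat_function_def)
  moreover have "(\<exists>G. guarded_params G (label c)) \<and>
    (\<forall>N. \<exists>xs. walk P (start P) xs \<and> denotes P (param_envs N) (start P) xs (label c))"
    using S(1)
  proof cases
    case no_template
    obtain l' where st: "step P (label u) l' (label c)"
      using no_template(2) S(2) by (auto simp: classic_expansion_def)
    have "guarded_params G (label c)"
      using G state_params_step[OF wf st] pc_step[OF st]
      unfolding guarded_params_def by blast
    moreover have "\<exists>xs. walk P (start P) xs \<and> denotes P (param_envs N) (start P) xs (label c)" for N
    proof -
      obtain xs where xs: "walk P (start P) xs"
        "denotes P (param_envs N) (start P) xs (label u)"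
        using child(3) by blast
      have "walk P (start P) (xs @ [l'])"
        using xs(1) step_edge[OF st] denotesD(1)[OF xs(2)] by (simp add: walk_append)
      with denotes_step[OF wf xs(2) st] show ?thesis by blast
    qed
    ultimately show ?thesis by blast
  next
    case (use_template M k)
    obtain t where t: "t \<in> M" "label c = state_comp (label u) (rename_kappa k t)"
      using use_template(2) S(2) by auto
    have ts: "template_state_for P (loc (label u)) t"
      using templates use_template t(1) by blast
    show ?thesis
      using guarded_params_template[OF G ts] denotes_template[OF _ _ ts] child(3)
      unfolding t(2) by blast
  qed
  ultimately show ?case using c(1) by blast
qed

text \<open>Both nodes denote the same path, so an edge extends it feasibly for one exactly when it
  does for the other; a child of \<open>u\<close> would contradict that \<open>u'\<close> has
  none.\<close>

lemma classic_leaf: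
  assumes wf: "wf_program P" and sat: "sat_function sat" and total: "\<forall>\<phi>. sat \<phi> \<noteq> UNKNOWN"
    and u: "grown P sat (classic_expansion P) u" "denotes P UNIV l xs (label u)"
    and u': "grown P sat (compact_expansion P p) u'" "denotes P (param_envs N) l xs (label u')"
    and leaf: "leaf u'"
  shows "leaf u"
proof -
  have loc: "loc (label u) = loc (label u')"
    using denotesD(1)[OF u(2)] denotesD(1)[OF u'(2)] by simp
  show ?thesis
    using u'(1)
  proof cases
    case (final s)
    with u(1) loc show ?thesis by (auto elim: grown.cases simp: leaf_def)
  next
    case (expand s tmpl S C)
    \<comment> \<open>By the definition of \<open>leaf\<close> the expansion was classic, so every
      out-edge was tried and discarded.\<close>
    have "tmpl = None" "C = {||}" using leaf expand(1) by (auto simp: leaf_def)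
    with expand(3) obtain f where f: "\<forall>l' \<in> succs P (loc s). step P s l' (f l')"
      "S = f ` succs P (loc s)"
      by (auto elim!: compact_expansion.cases simp: classic_expansion_def)
    have unsat: "\<not> satisfiable (pc (f l'))" if "l' \<in> succs P (loc s)" for l'
      using expand(5) \<open>C = {||}\<close> f(2) that sat by (auto simp: sat_function_def)
    have infeasible: "\<not> feasible P l (xs @ [l']) A \<sigma>" if "l' \<in> succs P (loc s)" for l' A \<sigma>
    proof
      assume "feasible P l (xs @ [l']) A \<sigma>"
      \<comment> \<open>Initial values from \<open>\<sigma>\<close>, parameters from
        \<open>N\<close>: a model of the discarded path condition.\<close>
      let ?I = "case_atom \<sigma> (\<lambda>k. int (N k)) (\<lambda>_. 0)"
      have "step P (label u') l' (f l')" using f(1) that expand(1) by simp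
      from denotesD(4)[OF denotes_step[OF wf u'(2) this], of ?I]
      have "holds ?I A (pc (f l'))"
        using \<open>feasible P l (xs @ [l']) A \<sigma>\<close> by (simp add: param_envs_def)
      with unsat[OF that] show False by (auto simp: satisfiable_def)
    qed
    have "children u = {||}"
    proof (rule ccontr)
      assume "children u \<noteq> {||}"
      then obtain c where c: "c \<in> fset (children u)" by auto
      obtain S where "sat (pc (label c)) = SAT" "classic_expansion P (label u) (applied u) S"
        "label c \<in> S"
        using grown_child[OF u(1) c total] by blast
      moreover from this obtain l' where l': "l' \<in> succs P (loc (label u))"
        "step P (label u) l' (label c)"
        by (auto simp: classic_expansion_def)
      ultimately obtain I A where "holds I A (pc (label c))"
        using sat by (auto simp: sat_function_def satisfiable_def)
      then have "feasible P l (xs @ [l']) A (\<lambda>b. I (Symbol b))"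
        using denotesD(4)[OF denotes_step[OF wf u(2) l'(2)]] by simp
      with infeasible l'(1) loc expand(1) show False by simp
    qed
    moreover have "applied u = None"
      using u(1) by (auto elim!: grown.cases simp: classic_expansion_def)
    ultimately show ?thesis by (simp add: leaf_def)
  qed
qed

text \<open>Instantiating amounts to evaluating in an environment of \<open>param_envs N\<close>.
  Parameters left uninstantiated do not occur in \<open>s'\<close>, so their values cannot
  matter.\<close>

lemma state_equiv_instantiate:
  fixes s s' :: "('l, 'v, 'w) state"
  assumes "denotes P UNIV l xs s" and "denotes P (param_envs N) l xs s'"
  defines "\<nu> \<equiv> (\<lambda>k. if k \<in> state_params s' then Some (N k) else None)"
  shows "state_equiv P s (instantiate \<nu> s')"
proof -
  let ?f = "(\<lambda>k. case \<nu> k of Some n \<Rightarrow> Const (int n) | None \<Rightarrow> Atom (Param k))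
    :: nat \<Rightarrow> ('v, 'w) expr"
  have main: "ieval I A (ival (mem s) a) = ieval I A (isub (parsub ?f) ASymbol (ival (mem s') a)) \<and>
      (holds I A (pc s) \<longleftrightarrow> holds I A (fsub (parsub ?f) ASymbol (pc s')))"
    for I A a
  proof -
    define J where "J x = (case x of Param k \<Rightarrow> int (N k) | _ \<Rightarrow> I x)" for x
    have J: "J \<in> param_envs N" "(\<lambda>b. J (Symbol b)) = (\<lambda>b. I (Symbol b))"
      by (simp_all add: J_def param_envs_def)
    have "ieval (\<lambda>x. ieval I A (parsub ?f x)) A (ival (mem s') a) = ieval J A (ival (mem s') a)"
    proof (rule ieval_cong)
      show "ieval I A (parsub ?f x) = J x" if "x \<in> iatoms (ival (mem s') a)" for x
        using that by (auto simp: J_def ieval_parsub \<nu>_def state_params_def split: atom.split)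
    qed
    moreover have "holds (\<lambda>x. ieval I A (parsub ?f x)) A (pc s') \<longleftrightarrow> holds J A (pc s')"
      by (rule holds_cong) (auto simp: J_def ieval_parsub \<nu>_def state_params_def)
    ultimately show ?thesis
      using denotesD(3,4)[OF assms(1), of I] denotesD(3,4)[OF assms(2) J(1)] J(2)
      by (simp add: ieval_isub holds_fsub)
  qed
  then show ?thesis
    using denotesD(1,2)[OF assms(1)] denotesD(1,2)[OF assms(2)]
    by (simp add: state_equiv_def instantiate_def state_parsub_def mem_parsub_def expr_equiv_def
        aexp_equiv_def form_equiv_def)
qed

theorem theorem3:
  fixes P :: "('l, 'v, 'w) program"
    and sat :: "('v, 'w) formula \<Rightarrow> answer"
    and p :: "('l, 'v, 'w) template set"
    and T T' :: "('l, 'v, 'w) stree"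
  assumes "wf_program P"
    and "sat_function sat"
    and "finite p"
    and "\<forall>t \<in> p. \<exists>\<pi> e X. is_cycle P \<pi> e X \<and> template_alg P sat \<pi> e X t"
    and "classic_tree P sat T"
    and "compact_tree P sat p T'"
    and "\<forall>\<phi>. sat \<phi> \<noteq> UNKNOWN"
  shows "\<forall>e' \<in> nodes T'. leaf e' \<longrightarrow>
    (\<exists>e \<in> nodes T. leaf e \<and>
      (\<exists>\<nu>. valuation_of (state_params (label e')) \<nu> \<and>
        state_equiv P (label e) (instantiate \<nu> (label e'))))"
proof (intro ballI impI)
  fix e' assume e': "e' \<in> nodes T'" "leaf e'"
  let ?s = "label e'"
  have templates: "\<forall>(l, M)\<in>p. \<forall>t\<in>M. template_state_for P l t"
    using assms(4) template_alg_states[OF assms(1)] by fast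
  note node = compact_node[OF assms(1,2,6,7) templates e'(1)]
  obtain I A where I: "holds I A (pc ?s)"
    using node by (auto simp: satisfiable_def)
  obtain G where G: "guarded_params G ?s" using node by blast
  \<comment> \<open>The model supplies the parameter values. On the parameters of the path condition
    \<open>nat\<close> loses nothing, since they are guarded; there \<open>J\<close> agrees with
    \<open>I\<close>.\<close>
  define N where "N k = nat (I (Param k))" for k
  define J where "J x = (case x of Param k \<Rightarrow> int (N k) | _ \<Rightarrow> I x)" for x
  obtain xs where xs: "walk P (start P) xs" "denotes P (param_envs N) (start P) xs ?s"
    using node by blast
  have "I (Param k) = J (Param k)" if "Param k \<in> fatoms (pc ?s)" for k
  proof -
    have "k \<in> G" using G that by (auto simp: guarded_params_def state_params_def)
    then have "0 \<le> I (Param k)" using G I by (auto simp: guarded_params_def)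
    then show ?thesis by (simp add: J_def N_def)
  qed
  then have "holds J A (pc ?s)"
    using I holds_cong[of I J "pc ?s" A] by (simp add: J_def)
  moreover have "J \<in> param_envs N" by (simp add: J_def param_envs_def)
  ultimately have "feasible P (start P) xs A (\<lambda>b. J (Symbol b))"
    using denotesD(4)[OF xs(2)] by blast
  then obtain e where e: "e \<in> nodes T" "grown P sat (classic_expansion P) e"
    "denotes P UNIV (start P) xs (label e)"
    using classic_node[OF assms(1,2,5,7) xs(1)] by blast
  have "leaf e"
    using classic_leaf[OF assms(1,2,7) e(2,3) _ xs(2) e'(2)] node by blast
  moreover have "valuation_of (state_params ?s) (\<lambda>k. if k \<in> state_params ?s then Some (N k) else None)"
    using G by (auto simp: valuation_of_def guarded_params_def dom_def intro: finite_subset)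
  ultimately show "\<exists>e \<in> nodes T. leaf e \<and>
      (\<exists>\<nu>. valuation_of (state_params ?s) \<nu> \<and> state_equiv P (label e) (instantiate \<nu> ?s))"
    using e(1) state_equiv_instantiate[OF e(3) xs(2)] by blast
qed

end
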